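(* Let $\nu$ be a positive integer and, for $k=1,\dots,\nu$, let $N_k=n_k+n_{k+1}+\dots+n_\nu$. Then for every non-negative integer $M$, \begin{align*} \sum_{\substack{i,m,n_1,\dots,n_\nu\geq 0,\\ i+m \equiv N_1+N_2+\dots + N_\nu \ (\mathrm{mod}\ 2)}} &q^{\frac{m^2+3(i^2+N_1^2+N_2^2+\dots + N_\nu^2)}{2}} {M \brack i}_{q^3}{3n_\nu\brack m}_{q}\\ &\times {2n_\nu + \frac{i-N_1-N_2-\dots-N_\nu-m}{2}\brack 2n_\nu}_{q^3} \prod_{j=1}^{\nu-1} {i- \sum_{k=1}^j N_k+n_j \brack n_j}_{q^3}\\ &= \sum_{j=-\infty} ^\infty q^{3\binom{\nu+2}{2}j^2+j} {2M\brack M+(\nu+1)j}_{q^3}. \end{align*}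
   Context: For a variable $x$ and integer $n\ge 0$, $(x;x)_n=\prod_{k=1}^n(1-x^k)$. For integers $A,B$, ${A\brack B}_x=\frac{(x;x)_A}{(x;x)_B(x;x)_{A-B}}$ if $B\ge 0$ and $A-B\ge 0$, and $0$ otherwise. An empty product equals $1$. *)

theory Defs
  imports
    "HOL-Computational_Algebra.Polynomial_Factorial"
    "HOL-Library.Groups_Big_Fun"
    "HOL-Library.FuncSet"
    "HOL-Number_Theory.Cong"
begin

(* Q(q), the field of rational functions over the rationals in one variable. *)
type_synonym ratfun = "rat poly fract"

definition qvar :: ratfun where
  "qvar = to_fract [:0, 1:]"

definition q_poch :: "'a::comm_ring_1 \<Rightarrow> nat \<Rightarrow> 'a" where
  "q_poch x n = (\<Prod>k=1..n. 1 - x ^ k)"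

(* The quotient is the intended one whenever x is not a root of unity, in
   particular for x = qvar and x = qvar ^ 3; then all denominators are nonzero. *)
definition q_binomial :: "'a::field \<Rightarrow> int \<Rightarrow> int \<Rightarrow> 'a" where
  "q_binomial x A B =
     (if B \<ge> 0 \<and> A - B \<ge> 0
      then q_poch x (nat A) / (q_poch x (nat B) * q_poch x (nat (A - B)))
      else 0)"

(* With parts n 1, ..., n \<nu>, this is N_k = n_k + n_{k+1} + ... + n_\<nu>. *)
definition tail_sum :: "nat \<Rightarrow> (nat \<Rightarrow> nat) \<Rightarrow> nat \<Rightarrow> nat" where
  "tail_sum \<nu> n k = (\<Sum>l=k..\<nu>. n l)"

lemma q_poch_qvar_power_nonzero:
  assumes "e > 0"
  shows "q_poch (qvar ^ e) n \<noteq> 0"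
proof -
  have pow: "qvar ^ d = to_fract ([:0, 1:] ^ d)" for d
    by (induction d) (simp_all add: qvar_def flip: to_fract_mult)
  have "1 - (qvar ^ e) ^ k \<noteq> 0" if "k \<ge> 1" for k
  proof
    assume "1 - (qvar ^ e) ^ k = 0"
    then have "to_fract ([:0, 1:] ^ (e * k)) = (to_fract 1 :: ratfun)"
      using pow[of "e * k"] by (simp add: power_mult)
    then have "[:0, 1:] ^ (e * k) = (1 :: rat poly)"
      by (simp only: to_fract_eq_iff)
    then have "degree ([:0, 1:] ^ (e * k) :: rat poly) = 0"
      by simp
    then show False
      using assms that by (simp add: degree_power_eq)
  qed
  then show ?thesis
    by (auto simp: q_poch_def)
qed

(* Both sums in the identity are taken with Sum_any, the sum over the support
   of its argument, which is 0 by convention when the support is infinite; here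
   both supports are finite.  On the left, a nonzero summand
   has i \<le> M, m \<le> 3 n_\<nu> and N_1 + ... + N_\<nu> + m \<le> i by the first three
   q-binomials, and the tuples (n_1, ..., n_\<nu>) are represented by the functions
   in {1..\<nu>} \<rightarrow>\<^sub>E UNIV, so each tuple is counted once.  On the right,
   (\<nu> + 1) |j| \<le> M. *)

end

(* The left-hand side is expanded in Warnaar's refined q-trinomial coefficients, with Q = q^3,
     T(L,M,a,b) = sum over n with n + L + a even of
       Q^(n^2/2) [M;n] [M+b+(L-a-n)/2; M+b] [M-b+(L+a-n)/2; M-b].
   The innermost sum over m is the coefficient of z^L in
     prod_{k<3M} (1 + z q^(k+1/2)) / (z^2;Q)_{2M+1};
   splitting the product by k mod 3 and applying q-Saalschuetz turns it into
     sum_j q^j Q^(j^2/2) T(L,M,|j|,|j|).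
   Each further summation over some N_k is Warnaar's transformation (a, b >= 0)
     sum_i Q^(i^2/2) [L+M-i;L] T(L-i,i,a,b) = Q^(b^2/2) T(L,M,a+b,b),
   whose two sides satisfy the same Pascal-type recurrence in L and b and which for b = 0 is
   q-Saalschuetz term by term.  The sums over N_1 and i reduce T to [2M; M+(nu+1)j] in base Q. *)
theory Submission
  imports Defs "HOL-Computational_Algebra.Formal_Power_Series"
begin

text \<open>For \<open>b > 0\<close> the left side of Warnaar's transformation is not evaluated by
  q-Saalschuetz alone, and this obstacle shapes the proof. A contiguous relation trades (a, b + 1)
  against (a + 1, b) at the price of comparing i with i - 1; weighted by \<open>x ^ tri i\<close> it
  telescopes, and only Pascal differences of the outer binomial survive. Power series keep this
  manageable: passing from i - 1 to i multiplies by one linear factor of \<open>qprod\<close>, and a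
  shift of L is multiplication by \<open>fps_X\<close>. No binomial links i and N_1, so the sum over
  N_1 needs the limit M -> infinity of the transformation. Origin of the constants on the right: (a,
  b) starts at (|j|, |j|), and each of the nu transformations adds |j| to a, which ends at
  (nu+1)|j|, the shift in the final binomial. The exponent of Q collects j^2/2 from the start, j^2/2
  from each transformation and a^2/2 from the sum over i, in all ((nu+1) + (nu+1)^2) j^2/2 =
  binom(nu+2, 2) j^2.\<close>

definition tri :: "nat \<Rightarrow> nat" where
  "tri n = n * (n + 1) div 2"

lemma tri_0 [simp]: "tri 0 = 0"
  by (simp add: tri_def)

lemma tri_Suc: "tri (Suc n) = tri n + Suc n"
proof -
  have "Suc n * (Suc n + 1) = n * (n + 1) + 2 * Suc n" by (simp add: algebra_simps)
  then show ?thesis unfolding tri_def by simp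
qed

lemma two_tri: "2 * tri n = n * (n + 1)"
  by (simp add: tri_def)

lemma tri_add: "tri (a + b) = tri a + tri b + a * b"
  by (rule mult_left_cancel[of 2, THEN iffD1]) (simp_all only: distrib_left two_tri, simp_all add: algebra_simps)

section \<open>Gaussian binomials at a generic base: Pascal, Vandermonde, q-Saalschuetz\<close>

locale q_generic =
  fixes x :: "'a::field"
  assumes x_nonzero [simp]: "x \<noteq> 0"
    and not_root: "k > 0 \<Longrightarrow> x ^ k \<noteq> 1"
begin

text \<open>Indexed by the two sides of the box instead of top and bottom: exchanging them is a
  symmetry, and the vanishing condition is the same for both.\<close>

definition gauss :: "int \<Rightarrow> int \<Rightarrow> 'a" where
  "gauss m r = q_binomial x (m + r) r"

lemma q_poch_nonzero [simp]: "q_poch x n \<noteq> 0"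
  using not_root by (auto simp: q_poch_def)

lemma q_poch_Suc: "q_poch x (Suc n) = (1 - x ^ Suc n) * q_poch x n"
  by (simp add: q_poch_def)

lemma q_poch_0 [simp]: "q_poch x 0 = 1"
  by (simp add: q_poch_def)

lemma gauss_neg: "m < 0 \<or> r < 0 \<Longrightarrow> gauss m r = 0"
  by (auto simp: gauss_def q_binomial_def)

lemma gauss_of_nat: "gauss (int m) (int r) = q_poch x (m + r) / (q_poch x m * q_poch x r)"
  by (simp add: gauss_def q_binomial_def nat_add_distrib mult.commute)

lemma q_binomial_eq_gauss: "q_binomial x A B = gauss (A - B) B"
  by (simp add: gauss_def)

lemma gauss_commute: "gauss m r = gauss r m"
  by (auto simp: gauss_def q_binomial_def add.commute)

lemma gauss_0_right: "m \<ge> 0 \<Longrightarrow> gauss m 0 = 1"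
  using gauss_of_nat[of "nat m" 0] by simp

lemma gauss_0_left: "r \<ge> 0 \<Longrightarrow> gauss 0 r = 1"
  using gauss_0_right gauss_commute by metis

text \<open>Clearing denominators leaves 1 - x^(m+r) = (1 - x^m) + x^m (1 - x^r). At m = r = 0 the
  left side would be 1 and the right side 0; excluding this point is the side condition of every
  later use.\<close>

lemma gauss_pascal:
  assumes "m \<noteq> 0 \<or> r \<noteq> 0"
  shows "gauss m r = gauss (m - 1) r + x powi m * gauss m (r - 1)"
proof (cases "m < 0 \<or> r < 0")
  case True
  then show ?thesis by (auto simp: gauss_neg)
next
  case False
  then obtain m' r' where mr: "m = int m'" "r = int r'"
    by (metis nonneg_int_cases not_le)
  show ?thesis
  proof (cases "m' = 0 \<or> r' = 0")
    case True
    then show ?thesis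
      using assms mr by (auto simp: gauss_neg gauss_0_right gauss_0_left)
  next
    case False
    then obtain m2 r2 where m2: "m' = Suc m2" "r' = Suc r2"
      by (metis not0_implies_Suc)
    have e: "m - 1 = int m2" "r - 1 = int r2"
      using mr m2 by auto
    have nz: "1 - x ^ Suc m2 \<noteq> 0" "1 - x ^ Suc r2 \<noteq> 0"
      using not_root[of "Suc m2"] not_root[of "Suc r2"] by simp_all
    have n1: "1 - x ^ Suc (Suc (m2 + r2)) = (1 - x ^ Suc m2) + x ^ Suc m2 * (1 - x ^ Suc r2)"
      by (simp add: algebra_simps power_add)
    have c1: "gauss m r = (1 - x ^ Suc (Suc (m2 + r2))) * q_poch x (Suc (m2 + r2)) / (((1 - x ^ Suc m2) * q_poch x m2) * ((1 - x ^ Suc r2) * q_poch x r2))"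
      unfolding mr gauss_of_nat m2 by (simp only: q_poch_Suc add_Suc add_Suc_right)
    have c2: "gauss (m - 1) r = q_poch x (Suc (m2 + r2)) / (q_poch x m2 * ((1 - x ^ Suc r2) * q_poch x r2))"
      unfolding e unfolding mr gauss_of_nat m2 by (simp only: q_poch_Suc add_Suc add_Suc_right)
    have c3: "gauss m (r - 1) = q_poch x (Suc (m2 + r2)) / (((1 - x ^ Suc m2) * q_poch x m2) * q_poch x r2)"
      unfolding e unfolding mr gauss_of_nat m2 by (simp only: q_poch_Suc add_Suc add_Suc_right)
    define u v W where "u = 1 - x ^ Suc m2" and "v = 1 - x ^ Suc r2" and "W = q_poch x (Suc (m2 + r2))"
    have pm: "x powi m = x ^ Suc m2"
      unfolding mr m2 power_int_of_nat ..
    have "(u + x ^ Suc m2 * v) * W / ((u * a) * (v * b))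
      = W / (a * (v * b)) + x ^ Suc m2 * (W / ((u * a) * b))" if "a \<noteq> 0" "b \<noteq> 0" for a b
      using nz that unfolding u_def[symmetric] v_def[symmetric]
      by (simp add: divide_simps) (simp add: algebra_simps)
    from this[of "q_poch x m2" "q_poch x r2"]
    show ?thesis
      unfolding c1 c2 c3 pm n1 u_def v_def W_def by simp
  qed
qed

definition qbin :: "nat \<Rightarrow> nat \<Rightarrow> 'a" where
  "qbin n k = q_binomial x (int n) (int k)"

lemma qbin_eq_gauss: "qbin n k = gauss (int n - int k) (int k)"
  by (simp add: qbin_def gauss_def)

lemma gauss_eq_qbin: "gauss (int m) (int r) = qbin (m + r) r"
  by (simp add: qbin_def gauss_def)

lemma qbin_zero: "k > n \<Longrightarrow> qbin n k = 0"
  by (simp add: qbin_eq_gauss gauss_neg)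

lemma qbin_eq: "k \<le> n \<Longrightarrow> qbin n k = q_poch x n / (q_poch x k * q_poch x (n - k))"
  by (simp add: qbin_def q_binomial_def nat_diff_distrib)

lemma qbin_sym: "k \<le> n \<Longrightarrow> qbin n (n - k) = qbin n k"
  by (simp add: qbin_eq mult.commute)

lemma qbin_0 [simp]: "qbin n 0 = 1"
  by (simp add: qbin_eq)

lemma qbin_Suc_Suc: "qbin (Suc n) (Suc k) = qbin n (Suc k) + x ^ (n - k) * qbin n k"
proof (cases "k \<le> n")
  case True
  have e: "int (Suc n) - int (Suc k) = int (n - k)" using True by simp
  show ?thesis
    unfolding qbin_eq_gauss e using gauss_pascal[of "int (n - k)" "int (Suc k)"] True
    by (simp add: of_nat_diff power_int_of_nat[symmetric] algebra_simps del: power_int_of_nat)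
next
  case False
  then show ?thesis by (simp add: qbin_zero)
qed

text \<open>The finite q-binomial theorem. The scalar c is kept because the upper block in
  \<open>qbin_Vandermonde\<close> is this product at \<open>c = x ^ m\<close>, and the outer thirds
  in \<open>prod_thirds\<close> are it at \<open>c = q\<close> and
  \<open>c = inverse q\<close>.\<close>

lemma prod_linear_nth:
  "fps_nth (\<Prod>k=1..n. 1 + fps_const (c * x ^ k) * fps_X) m
    = c ^ m * x ^ tri m * qbin n m"
proof (induction n arbitrary: m)
  case 0
  show ?case by (cases m) (simp_all add: qbin_zero)
next
  case (Suc n)
  define F where "F = (\<Prod>k=1..n. 1 + fps_const (c * x ^ k) * fps_X)"
  have IH: "fps_nth F m = c ^ m * x ^ tri m * qbin n m" for m
    unfolding F_def by (rule Suc.IH)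
  have step: "(\<Prod>k=1..Suc n. 1 + fps_const (c * x ^ k) * fps_X)
      = F + fps_const (c * x ^ Suc n) * (fps_X * F)"
    by (simp add: F_def algebra_simps)
  show ?case
  proof (cases m)
    case 0
    then show ?thesis unfolding step using IH[of 0] by simp
  next
    case (Suc k)
    show ?thesis
    proof (cases "k \<le> n")
      case True
      have p: "x ^ tri m * x ^ (n - k) = x ^ tri k * x ^ Suc n"
        unfolding Suc tri_Suc power_add[symmetric]
        by (rule arg_cong[where f = "power x"]) (use True in simp)
      have "fps_nth (F + fps_const (c * x ^ Suc n) * (fps_X * F)) m
        = c ^ m * x ^ tri m * qbin n m
          + c * x ^ Suc n * (c ^ k * x ^ tri k * qbin n k)"
        unfolding fps_add_nth fps_mult_left_const_nth IH by (simp add: Suc IH del: power_Suc)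
      also have "\<dots> = c ^ m * x ^ tri m * qbin n m
          + c ^ m * (x ^ tri k * x ^ Suc n) * qbin n k"
        by (simp add: Suc mult_ac)
      also have "\<dots> = c ^ m * x ^ tri m * qbin (Suc n) m"
        unfolding p[symmetric] by (simp add: Suc qbin_Suc_Suc algebra_simps)
      finally show ?thesis unfolding step .
    next
      case False
      then show ?thesis
        unfolding step Suc by (simp add: IH qbin_zero)
    qed
  qed
qed

text \<open>Cut the product at m and compare coefficients of \<open>fps_X ^ r\<close>. The truncated
  difference m - k is harmless, since \<open>qbin m k\<close> is 0 for k > m.\<close>

lemma qbin_Vandermonde:
  "qbin (m + n) r = (\<Sum>k\<le>r. x ^ ((m - k) * (r - k)) * qbin m k * qbin n (r - k))"
proof -
  let ?f = "\<lambda>k. 1 + fps_const (1 * x ^ k) * fps_X"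
  have "(\<Prod>k=1..m + n. ?f k) = (\<Prod>k=1..m. ?f k) * (\<Prod>k=m+1..m + n. ?f k)"
    by (rule prod.ub_add_nat) simp
  also have "(\<Prod>k=m+1..m + n. ?f k) = (\<Prod>k=1..n. 1 + fps_const (x ^ m * x ^ k) * fps_X)"
    using prod.shift_bounds_cl_nat_ivl[of ?f 1 m n] by (simp add: power_add mult.commute add.commute)
  finally have "fps_nth (\<Prod>k=1..m + n. ?f k) r
     = (\<Sum>k\<le>r. fps_nth (\<Prod>k=1..m. ?f k) k
          * fps_nth (\<Prod>k=1..n. 1 + fps_const (x ^ m * x ^ k) * fps_X) (r - k))"
    by (simp add: fps_mult_nth atLeast0AtMost)
  also have "\<dots> = (\<Sum>k\<le>r. x ^ tri r * (x ^ ((m - k) * (r - k)) * qbin m k * qbin n (r - k)))"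
  proof (rule sum.cong[OF refl])
    fix k assume "k \<in> {..r}"
    then obtain l where r: "r = k + l" by (auto simp: le_iff_add)
    show "fps_nth (\<Prod>k=1..m. ?f k) k * fps_nth (\<Prod>k=1..n. 1 + fps_const (x ^ m * x ^ k) * fps_X) (r - k)
      = x ^ tri r * (x ^ ((m - k) * (r - k)) * qbin m k * qbin n (r - k))"
    proof (cases "k \<le> m")
      case True
      then obtain d where m: "m = k + d" by (auto simp: le_iff_add)
      have "x ^ tri k * (x ^ m) ^ l * x ^ tri l
        = x ^ tri r * x ^ (d * l)"
        unfolding r tri_add m power_mult[symmetric] power_add[symmetric]
        by (rule arg_cong[where f = "power x"]) (simp add: algebra_simps)
      then show ?thesis
        unfolding prod_linear_nth by (simp add: r m mult_ac)
    next
      case False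
      then show ?thesis unfolding prod_linear_nth by (simp add: qbin_zero)
    qed
  qed
  finally show ?thesis
    unfolding prod_linear_nth by (simp add: sum_distrib_left[symmetric])
qed

text \<open>Trinomial revision: both products are the q-multinomial coefficient with parts k, j and
  n - k - j.\<close>

lemma qbin_mult_qbin: "qbin n k * qbin (n - k) j = qbin n (k + j) * qbin (k + j) k"
proof (cases "k + j \<le> n")
  case True
  then show ?thesis by (simp add: qbin_eq)
next
  case False
  then show ?thesis by (cases "k \<le> n") (auto simp: qbin_zero)
qed

text \<open>Complementing the summation index in \<open>qbin_Vandermonde\<close> produces the weight
  j (j + p), the shape in which the sums below arise.\<close>

lemma qbin_Vandermonde':
  "qbin (m + n) (m + p) = (\<Sum>j\<le>m. x ^ (j * (j + p)) * qbin m j * qbin n (p + j))"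
proof (cases "p \<le> n")
  case False
  then show ?thesis by (simp add: qbin_zero)
next
  case True
  then obtain r where n: "n = p + r" by (auto simp: le_iff_add)
  have "qbin (m + n) (m + p) = qbin (n + m) r"
    using qbin_sym[of r "n + m"] by (simp add: n add_ac)
  also have "\<dots> = (\<Sum>k\<le>r. x ^ ((n - k) * (r - k)) * qbin n k * qbin m (r - k))"
    by (rule qbin_Vandermonde)
  also have "\<dots> = (\<Sum>j\<le>r. x ^ ((n - (r - j)) * j) * qbin n (r - j) * qbin m j)"
    by (rule sum.reindex_bij_witness[of _ "\<lambda>j. r - j" "\<lambda>j. r - j"]) auto
  also have "\<dots> = (\<Sum>j\<le>r. x ^ (j * (j + p)) * qbin m j * qbin n (p + j))"
  proof (rule sum.cong[OF refl])
    fix j assume j: "j \<in> {..r}"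
    then have "qbin n (r - j) = qbin n (p + j)"
      using qbin_sym[of "p + j" n] by (simp add: n)
    with j show "x ^ ((n - (r - j)) * j) * qbin n (r - j) * qbin m j = x ^ (j * (j + p)) * qbin m j * qbin n (p + j)"
      by (simp add: n mult_ac add_ac)
  qed
  also have "\<dots> = (\<Sum>j\<le>m. x ^ (j * (j + p)) * qbin m j * qbin n (p + j))"
    by (rule sum.mono_neutral_cong) (auto simp: qbin_zero n)
  finally show ?thesis .
qed

text \<open>
  Vandermonde for \<open>qbin (M + v) v\<close> turns the left-hand side, and
  Vandermonde for the last factor turns the right-hand side, into the same sum over \<open>l\<close>.
\<close>

lemma qbin_Saalschuetz:
  "gauss (int M - int d) (int (u + d)) * qbin (M + v) v
    = (\<Sum>k\<le>v. x ^ (k * (k + d)) * qbin u k * qbin (v + d) (d + k)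
                * gauss (int M - int d - int k) (int (u + v + d)))"
proof (cases "d \<le> M")
  case False
  then show ?thesis by (simp add: gauss_neg)
next
  case True
  define N where "N = M - d"
  have M: "M = N + d" using True by (simp add: N_def)
  define Z where "Z = (\<lambda>l. x ^ (l * (l + d)) * qbin (v + d) (d + l) * qbin (u + d + l) l * qbin (M + u) (u + d + l))"
  have L1: "qbin (M + v) v = (\<Sum>l\<le>N. x ^ (l * (l + d)) * qbin N l * qbin (v + d) (d + l))"
    using qbin_Vandermonde'[of N "v + d" d] qbin_sym[of v "M + v"] by (simp add: M add_ac)
  have "gauss (int M - int d) (int (u + d)) = qbin (M + u) (u + d)"
    unfolding qbin_eq_gauss by (simp add: M)
  moreover have "qbin (M + u) (u + d) * qbin N l = qbin (u + d + l) l * qbin (M + u) (u + d + l)" for l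
  proof -
    have "M + u - (u + d) = N" by (simp add: M)
    moreover have "qbin (u + d + l) (u + d) = qbin (u + d + l) l"
      using qbin_sym[of l "u + d + l"] by simp
    ultimately show ?thesis
      using qbin_mult_qbin[of "M + u" "u + d" l] by (simp add: mult.commute)
  qed
  ultimately have "gauss (int M - int d) (int (u + d)) * qbin (M + v) v = (\<Sum>l\<le>N. Z l)"
    unfolding L1 sum_distrib_left by (intro sum.cong) (simp_all add: Z_def mult_ac)
  also have "\<dots> = (\<Sum>l\<le>v. Z l)"
    by (rule sum.mono_neutral_cong) (auto simp: Z_def M qbin_zero)
  also have "\<dots> = (\<Sum>l\<le>v. \<Sum>k\<le>l. x ^ (l * (l + d)) * qbin (v + d) (d + l) * qbin (M + u) (u + d + l)
                      * (x ^ ((u - k) * (l - k)) * qbin u k * qbin (d + l) (l - k)))"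
  proof (rule sum.cong[OF refl])
    fix l
    have "qbin (u + d + l) l = (\<Sum>k\<le>l. x ^ ((u - k) * (l - k)) * qbin u k * qbin (d + l) (l - k))"
      using qbin_Vandermonde[of u "d + l" l] by (simp add: add_ac)
    then show "Z l = (\<Sum>k\<le>l. x ^ (l * (l + d)) * qbin (v + d) (d + l) * qbin (M + u) (u + d + l)
                      * (x ^ ((u - k) * (l - k)) * qbin u k * qbin (d + l) (l - k)))"
      unfolding sum_distrib_left[symmetric] by (simp add: Z_def)
  qed
  also have "\<dots> = (\<Sum>k\<le>v. \<Sum>j\<le>v - k. x ^ ((k + j) * (k + j + d)) * qbin (v + d) (d + (k + j)) * qbin (M + u) (u + d + (k + j))
                      * (x ^ ((u - k) * j) * qbin u k * qbin (d + (k + j)) j))"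
    unfolding sum.Sigma[OF finite_atMost ballI[OF finite_atMost]]
    by (rule sum.reindex_bij_witness[of _ "\<lambda>(k, j). (k + j, k)" "\<lambda>(l, k). (k, l - k)"]) auto
  also have "\<dots> = (\<Sum>k\<le>v. x ^ (k * (k + d)) * qbin u k * qbin (v + d) (d + k)
                * gauss (int M - int d - int k) (int (u + v + d)))"
  proof (rule sum.cong[OF refl])
    fix k assume "k \<in> {..v}"
    then obtain w where v: "v = k + w" by (auto simp: le_iff_add)
    have c: "gauss (int M - int d - int k) (int (u + v + d)) = qbin (w + (M + u)) (w + (u + d + k))"
      unfolding qbin_eq_gauss by (simp add: v algebra_simps)
    show "(\<Sum>j\<le>v - k. x ^ ((k + j) * (k + j + d)) * qbin (v + d) (d + (k + j)) * qbin (M + u) (u + d + (k + j))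
                      * (x ^ ((u - k) * j) * qbin u k * qbin (d + (k + j)) j))
      = x ^ (k * (k + d)) * qbin u k * qbin (v + d) (d + k) * gauss (int M - int d - int k) (int (u + v + d))"
      unfolding c qbin_Vandermonde' sum_distrib_left
    proof (rule sum.cong)
      fix j assume "j \<in> {..w}"
      have q: "qbin (v + d) (d + k) * qbin w j = qbin (v + d) (d + (k + j)) * qbin (d + (k + j)) j"
        using qbin_mult_qbin[of "v + d" "d + k" j] qbin_sym[of j "d + (k + j)"] by (simp add: v add_ac)
      show "x ^ ((k + j) * (k + j + d)) * qbin (v + d) (d + (k + j)) * qbin (M + u) (u + d + (k + j))
                      * (x ^ ((u - k) * j) * qbin u k * qbin (d + (k + j)) j)
        = x ^ (k * (k + d)) * qbin u k * qbin (v + d) (d + k) *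
           (x ^ (j * (j + (u + d + k))) * qbin w j * qbin (M + u) (u + d + k + j))"
      proof (cases "k \<le> u")
        case True
        then obtain e where u: "u = k + e" by (auto simp: le_iff_add)
        have "x ^ ((k + j) * (k + j + d)) * x ^ ((u - k) * j) = x ^ (k * (k + d)) * x ^ (j * (j + (u + d + k)))"
          unfolding power_add[symmetric] by (rule arg_cong[where f = "power x"]) (simp add: u algebra_simps)
        then have "x ^ ((k + j) * (k + j + d)) * x ^ ((u - k) * j) * (qbin (v + d) (d + (k + j)) * qbin (d + (k + j)) j)
           = x ^ (k * (k + d)) * x ^ (j * (j + (u + d + k))) * (qbin (v + d) (d + k) * qbin w j)"
          unfolding q by simp
        then show ?thesis by (simp add: mult_ac add_ac)
      next
        case False
        then show ?thesis by (simp add: qbin_zero)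
      qed
    qed (simp add: v)
  qed
  finally show ?thesis .
qed

section \<open>Refined q-trinomial coefficients and their contiguous relations\<close>

text \<open>
  The factor \<open>x powi ((k + a) div 2)\<close> and the triangular exponent in \<open>qprod\<close> come from multiplying
  the refined \<open>q\<close>-trinomial coefficient \<open>T(L, i, a, b)\<close> by \<open>x\<close> to the power \<open>(L + a) / 2\<close>, which makes
  all exponents integers.  With this normalisation it is the coefficient of \<open>X ^ L\<close> in
  \<open>trinomial a b i\<close>.
\<close>

definition trinom_term :: "int \<Rightarrow> int \<Rightarrow> int \<Rightarrow> int \<Rightarrow> 'a" where
  "trinom_term a b i k = (if even (k - a)
     then x powi ((k + a) div 2) * gauss (i + b) ((k - a) div 2) * gauss (i - b) ((k + a) div 2) else 0)"

lemma trinom_term_even: "k = a + 2 * r \<Longrightarrow> trinom_term a b i k = x powi (r + a) * gauss (i + b) r * gauss (i - b) (r + a)"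
  by (simp add: trinom_term_def add.commute)

lemma trinom_term_odd: "odd (k - a) \<Longrightarrow> trinom_term a b i k = 0"
  by (simp add: trinom_term_def)

lemma trinom_term_less: "k < a \<Longrightarrow> trinom_term a b i k = 0"
  by (auto simp: trinom_term_def gauss_neg)

lemma powi_add: "x powi (m + n) = x powi m * x powi n"
  by (simp add: power_int_add)

lemma powi_diff: "x powi (m - n) = x powi m / x powi n"
  by (simp add: power_int_diff)

lemma powi_nonzero [simp]: "x powi n \<noteq> 0"
  by simp

text \<open>The left side is a coefficient of (1 + x^i X) times the series with coefficients g. That
  linear factor is the quotient of \<open>qprod i\<close> by \<open>qprod (i - 1)\<close>, so
  multiplying by \<open>qprod (i - 1)\<close> yields a relation between levels i and i - 1. In
  either parity class half of the terms vanish, and Pascal's rule settles the rest.\<close>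

lemma trinom_term_contiguous:
  assumes "b \<ge> 1" "i \<ge> 1" "a \<ge> 0"
  defines "g \<equiv> \<lambda>k. trinom_term a b i k - x powi (b - 1) * trinom_term (a + 1) (b - 1) i k
     - x powi (b + i) * trinom_term (a + 1) b i (k - 1) + x powi (i + 1) * trinom_term a (b - 1) i (k - 1)"
  shows "g k + x powi i * g (k - 1) = trinom_term a (b - 1) (i - 1) k - x powi (b - 1) * trinom_term (a + 1) b (i - 1) k"
proof (cases "even (k - a)")
  case True
  then obtain r where "k - a = 2 * r" by (elim evenE)
  then have k: "k = a + 2 * r" by simp
  define A I B where "A = x powi (r + a)" and "I = x powi i" and "B = x powi b"
  have p1: "gauss (i + b) r = gauss (i + b - 1) r + B * I * gauss (i + b) (r - 1)"
    using gauss_pascal[of "i + b" r] assms(1,2) by (simp add: powi_add B_def I_def)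
  \<comment> \<open>The cofactor keeps Pascal's rule away from the origin: it vanishes for r < 1,
    and for r >= 1 the argument r + a is positive.\<close>
  have p2: "gauss (i + b - 1) (r - 1) * gauss (i - b + 1) (r + a)
    = gauss (i + b - 1) (r - 1) * (gauss (i - b) (r + a) + I / B * x * gauss (i - b + 1) (r + a - 1))"
  proof (cases "r \<ge> 1")
    case True
    then show ?thesis using gauss_pascal[of "i - b + 1" "r + a"] assms(3)
      by (simp add: powi_add powi_diff B_def I_def)
  qed (simp add: gauss_neg)
  have p3: "gauss (i - b) (r + a) * gauss (i + b - 1) r
    = gauss (i - b) (r + a) * (gauss (i + b - 2) r + I * B / x * gauss (i + b - 1) (r - 1))"
    using gauss_pascal[of "i + b - 1" r] assms(1,2) by (simp add: powi_add powi_diff B_def I_def)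
  have e1: "trinom_term a b i k = A * gauss (i + b) r * gauss (i - b) (r + a)"
    unfolding A_def by (rule trinom_term_even) (simp add: k)
  have e2: "trinom_term (a + 1) b i (k - 1) = A * gauss (i + b) (r - 1) * gauss (i - b) (r + a)"
    by (subst trinom_term_even[where r = "r - 1"]) (simp_all add: k A_def add.commute)
  have e3: "trinom_term (a + 1) (b - 1) i (k - 1) = A * gauss (i + b - 1) (r - 1) * gauss (i - b + 1) (r + a)"
    by (subst trinom_term_even[where r = "r - 1"]) (simp_all add: k A_def algebra_simps)
  have e4: "trinom_term a (b - 1) i (k - 1 - 1) = A / x * gauss (i + b - 1) (r - 1) * gauss (i - b + 1) (r + a - 1)"
    by (subst trinom_term_even[where r = "r - 1"]) (simp_all add: k A_def powi_add powi_diff algebra_simps)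
  have o: "trinom_term (a + 1) (b - 1) i k = 0" "trinom_term a (b - 1) i (k - 1) = 0" "trinom_term a b i (k - 1) = 0" "trinom_term (a + 1) b i (k - 1 - 1) = 0"
    by (rule trinom_term_odd, simp add: k)+
  have pw: "x powi (b - 1) = B / x" "x powi (b + i) = B * I" "x powi (i + 1) = I * x"
    by (simp_all add: B_def I_def powi_add powi_diff)
  have t1: "g k = A * gauss (i + b) r * gauss (i - b) (r + a) - B * I * A * gauss (i + b) (r - 1) * gauss (i - b) (r + a)"
    unfolding g_def e1 e2 o pw by simp
  have t2: "g (k - 1) = - (B / x) * A * gauss (i + b - 1) (r - 1) * gauss (i - b + 1) (r + a)
     + I * A * gauss (i + b - 1) (r - 1) * gauss (i - b + 1) (r + a - 1)"
    unfolding g_def e3 e4 o pw by simp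
  have t3: "trinom_term a (b - 1) (i - 1) k = A * gauss (i + b - 2) r * gauss (i - b) (r + a)"
    unfolding A_def trinom_term_even[OF k] by (simp add: algebra_simps)
  have t4: "trinom_term (a + 1) b (i - 1) k = 0"
    by (rule trinom_term_odd) (simp add: k)
  have "g k + I * g (k - 1) = A * (gauss (i - b) (r + a) * gauss (i + b - 1) r
     - I * B / x * (gauss (i + b - 1) (r - 1) * gauss (i - b + 1) (r + a))
     + I * I * (gauss (i + b - 1) (r - 1) * gauss (i - b + 1) (r + a - 1)))"
    unfolding t1 t2 p1 by (simp add: algebra_simps)
  also have "\<dots> = A * (gauss (i - b) (r + a) * gauss (i + b - 2) r)"
    unfolding p2 p3 using powi_nonzero[of b, folded B_def] by (simp add: field_simps)
  finally show ?thesis unfolding t3 t4 I_def by (simp add: mult_ac)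
next
  case False
  then have "even (k - a - 1)" by simp
  then obtain r where "k - a - 1 = 2 * r" by (elim evenE)
  then have k: "k = a + 1 + 2 * r" by simp
  define A I B where "A = x powi (r + a)" and "I = x powi i" and "B = x powi b"
  have p1: "gauss (i + b) r = gauss (i + b - 1) r + B * I * gauss (i + b) (r - 1)"
    using gauss_pascal[of "i + b" r] assms(1,2) by (simp add: powi_add B_def I_def)
  have p2: "gauss (i + b - 1) r * gauss (i - b + 1) (r + a + 1)
    = gauss (i + b - 1) r * (gauss (i - b) (r + a + 1) + I / B * x * gauss (i - b + 1) (r + a))"
  proof (cases "r \<ge> 0")
    case True
    then show ?thesis using gauss_pascal[of "i - b + 1" "r + a + 1"] assms(3)
      by (simp add: powi_add powi_diff B_def I_def)
  qed (simp add: gauss_neg)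
  have p3: "gauss (i + b - 1) r * gauss (i - b) (r + a + 1)
    = gauss (i + b - 1) r * (gauss (i - b - 1) (r + a + 1) + I / B * gauss (i - b) (r + a))"
  proof (cases "r \<ge> 0")
    case True
    then show ?thesis using gauss_pascal[of "i - b" "r + a + 1"] assms(3)
      by (simp add: powi_add powi_diff B_def I_def)
  qed (simp add: gauss_neg)
  have e1: "trinom_term a b i (k - 1) = A * gauss (i + b) r * gauss (i - b) (r + a)"
    unfolding A_def by (rule trinom_term_even) (simp add: k)
  have e2: "trinom_term (a + 1) b i (k - 1 - 1) = A * gauss (i + b) (r - 1) * gauss (i - b) (r + a)"
    by (subst trinom_term_even[where r = "r - 1"]) (simp_all add: k A_def add.commute)
  have e3: "trinom_term (a + 1) (b - 1) i k = A * x * (gauss (i + b - 1) r * gauss (i - b + 1) (r + a + 1))"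
    by (subst trinom_term_even[where r = r]) (simp_all add: k A_def powi_add algebra_simps)
  have e4: "trinom_term a (b - 1) i (k - 1) = A * (gauss (i + b - 1) r * gauss (i - b + 1) (r + a))"
    by (subst trinom_term_even[where r = r]) (simp_all add: k A_def algebra_simps)
  have o: "trinom_term (a + 1) (b - 1) i (k - 1) = 0" "trinom_term a (b - 1) i (k - 1 - 1) = 0" "trinom_term a b i k = 0" "trinom_term (a + 1) b i (k - 1) = 0"
    by (rule trinom_term_odd, simp add: k)+
  have pw: "x powi (b - 1) = B / x" "x powi (b + i) = B * I" "x powi (i + 1) = I * x"
    by (simp_all add: B_def I_def powi_add powi_diff)
  have t1: "g k = - B * A * (gauss (i + b - 1) r * gauss (i - b + 1) (r + a + 1))
     + I * x * A * (gauss (i + b - 1) r * gauss (i - b + 1) (r + a))"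
    unfolding g_def e3 e4 o pw by simp
  have t2: "g (k - 1) = A * gauss (i + b) r * gauss (i - b) (r + a) - B * I * A * gauss (i + b) (r - 1) * gauss (i - b) (r + a)"
    unfolding g_def e1 e2 o pw by simp
  have t3: "trinom_term a (b - 1) (i - 1) k = 0"
    by (rule trinom_term_odd) (simp add: k)
  have t4: "trinom_term (a + 1) b (i - 1) k = x * A * (gauss (i + b - 1) r * gauss (i - b - 1) (r + a + 1))"
    by (subst trinom_term_even[where r = r]) (simp_all add: k A_def powi_add algebra_simps)
  have "g k + I * g (k - 1) = - B * A * (gauss (i + b - 1) r * gauss (i - b + 1) (r + a + 1))
     + I * x * A * (gauss (i + b - 1) r * gauss (i - b + 1) (r + a)) + I * A * (gauss (i + b - 1) r * gauss (i - b) (r + a))"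
    unfolding t1 t2 p1 by (simp add: algebra_simps)
  also have "\<dots> = - B * A * (gauss (i + b - 1) r * gauss (i - b - 1) (r + a + 1))"
    unfolding p2 unfolding distrib_left p3 using powi_nonzero[of b, folded B_def] by (simp add: field_simps)
  finally show ?thesis unfolding t3 t4 I_def B_def by (simp add: powi_diff mult_ac)
qed

text \<open>Here i stays fixed, so no linear factor is involved. This becomes the recurrence in L
  and b satisfied by the right side of Warnaar's transformation.\<close>

lemma trinom_term_pascal:
  assumes "b \<ge> 1" "i \<ge> 0" "a \<ge> 1"
  shows "x powi (b - 1) * trinom_term a b i k = x powi (b - 1) * trinom_term a (b - 1) i k
    + x powi (i + 2 * b - 1) * trinom_term (a + 1) b i (k - 1) - x powi (i + 1) * trinom_term (a - 1) (b - 1) i (k - 1)"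
proof (cases "even (k - a)")
  case True
  then obtain r where "k - a = 2 * r" by (elim evenE)
  then have k: "k = a + 2 * r" by simp
  define A I B where "A = x powi (r + a)" and "I = x powi i" and "B = x powi b"
  have p1: "gauss (i + b) r = gauss (i + b - 1) r + B * I * gauss (i + b) (r - 1)"
    using gauss_pascal[of "i + b" r] assms(1,2) by (simp add: powi_add B_def I_def)
  have p2: "gauss (i + b - 1) r * gauss (i - b + 1) (r + a)
    = gauss (i + b - 1) r * (gauss (i - b) (r + a) + I / B * x * gauss (i - b + 1) (r + a - 1))"
  proof (cases "r \<ge> 0")
    case True
    then show ?thesis using gauss_pascal[of "i - b + 1" "r + a"] assms(3)
      by (simp add: powi_add powi_diff B_def I_def)
  qed (simp add: gauss_neg)
  have B2: "x powi (2 * b) = B * B" using powi_add[of b b] by (simp add: B_def)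
  have e1: "trinom_term a b i k = A * gauss (i + b) r * gauss (i - b) (r + a)"
    unfolding A_def by (rule trinom_term_even) (simp add: k)
  have e2: "trinom_term a (b - 1) i k = A * (gauss (i + b - 1) r * gauss (i - b + 1) (r + a))"
    by (subst trinom_term_even[where r = r]) (simp_all add: k A_def algebra_simps)
  have e3: "trinom_term (a + 1) b i (k - 1) = A * gauss (i + b) (r - 1) * gauss (i - b) (r + a)"
    by (subst trinom_term_even[where r = "r - 1"]) (simp_all add: k A_def add.commute)
  have e4: "trinom_term (a - 1) (b - 1) i (k - 1) = A / x * gauss (i + b - 1) r * gauss (i - b + 1) (r + a - 1)"
    by (subst trinom_term_even[where r = r]) (simp_all add: k A_def powi_add powi_diff algebra_simps)
  have pw: "x powi (b - 1) = B / x" "x powi (i + 2 * b - 1) = I * (B * B) / x" "x powi (i + 1) = I * x"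
    by (simp_all add: B_def I_def powi_add powi_diff B2)
  have "B / x * (A * (gauss (i + b - 1) r + B * I * gauss (i + b) (r - 1)) * gauss (i - b) (r + a))
    = B / x * (A * (gauss (i + b - 1) r * (gauss (i - b) (r + a) + I / B * x * gauss (i - b + 1) (r + a - 1))))
     + I * (B * B) / x * (A * gauss (i + b) (r - 1) * gauss (i - b) (r + a))
     - I * x * (A / x * gauss (i + b - 1) r * gauss (i - b + 1) (r + a - 1))"
    using powi_nonzero[of b, folded B_def] by (simp add: field_simps)
  then show ?thesis unfolding e1 e2 e3 e4 pw p1 p2 .
qed (simp add: trinom_term_odd)

definition trinom_series :: "nat \<Rightarrow> nat \<Rightarrow> nat \<Rightarrow> 'a fps" where
  "trinom_series a b i = Abs_fps (\<lambda>k. trinom_term (int a) (int b) (int i) (int k))"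

lemma trinom_series_nth: "fps_nth (trinom_series a b i) k = trinom_term (int a) (int b) (int i) (int k)"
  by (simp add: trinom_series_def)

text \<open>At k = 0 the index is -1, below a, where \<open>trinom_term\<close> vanishes; integer
  indices thus absorb the boundary case of the shift.\<close>

lemma X_trinom_series_nth: "fps_nth (fps_X * trinom_series a b i) k = trinom_term (int a) (int b) (int i) (int k - 1)"
  by (cases k) (simp_all add: trinom_series_nth trinom_term_less)

lemma X_X_trinom_series_nth: "fps_nth (fps_X * (fps_X * trinom_series a b i)) k = trinom_term (int a) (int b) (int i) (int k - 2)"
  by (cases k; cases "k - 1") (auto simp: trinom_series_nth trinom_term_less)

definition qprod :: "nat \<Rightarrow> 'a fps" where
  "qprod i = (\<Prod>k=1..i. 1 + fps_const (x ^ k) * fps_X)"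

lemma qprod_0 [simp]: "qprod 0 = 1"
  by (simp add: qprod_def)

lemma qprod_Suc: "qprod (Suc i) = qprod i * (1 + fps_const (x ^ Suc i) * fps_X)"
  by (simp add: qprod_def)

definition trinomial :: "nat \<Rightarrow> nat \<Rightarrow> nat \<Rightarrow> 'a fps" where
  "trinomial a b i = qprod i * trinom_series a b i"

lemma trinom_series_contiguous:
  "(1 + fps_const (x ^ Suc i) * fps_X)
     * (trinom_series a (Suc b) (Suc i) - fps_const (x ^ b) * trinom_series (Suc a) b (Suc i)
        - fps_const (x ^ (Suc b + Suc i)) * (fps_X * trinom_series (Suc a) (Suc b) (Suc i))
        + fps_const (x ^ Suc (Suc i)) * (fps_X * trinom_series a b (Suc i)))
   = trinom_series a b i - fps_const (x ^ b) * trinom_series (Suc a) (Suc b) i" (is "?L = ?R")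
proof (rule fps_ext)
  fix k
  define g where "g = trinom_series a (Suc b) (Suc i) - fps_const (x ^ b) * trinom_series (Suc a) b (Suc i)
        - fps_const (x ^ (Suc b + Suc i)) * (fps_X * trinom_series (Suc a) (Suc b) (Suc i))
        + fps_const (x ^ Suc (Suc i)) * (fps_X * trinom_series a b (Suc i))"
  define G where "G = (\<lambda>k. trinom_term a (int (Suc b)) (int (Suc i)) k - x powi (int (Suc b) - 1) * trinom_term (int a + 1) (int (Suc b) - 1) (int (Suc i)) k
     - x powi (int (Suc b) + int (Suc i)) * trinom_term (int a + 1) (int (Suc b)) (int (Suc i)) (k - 1) + x powi (int (Suc i) + 1) * trinom_term a (int (Suc b) - 1) (int (Suc i)) (k - 1))"
  have pw: "x powi (int (Suc b) - 1) = x ^ b" "x powi (int (Suc b) + int (Suc i)) = x ^ (Suc b + Suc i)"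
     "x powi (int (Suc i) + 1) = x ^ Suc (Suc i)"
    unfolding power_int_of_nat[symmetric] by (rule arg_cong[where f = "power_int x"]; simp)+
  have g1: "fps_nth g k = G (int k)" for k
    unfolding g_def G_def fps_add_nth fps_sub_nth fps_mult_left_const_nth trinom_series_nth X_trinom_series_nth pw
    by (simp add: add_ac)
  have g2: "fps_nth (fps_X * g) k = G (int k - 1)"
  proof -
    have "fps_X * g = fps_X * trinom_series a (Suc b) (Suc i) - fps_const (x ^ b) * (fps_X * trinom_series (Suc a) b (Suc i))
        - fps_const (x ^ (Suc b + Suc i)) * (fps_X * (fps_X * trinom_series (Suc a) (Suc b) (Suc i)))
        + fps_const (x ^ Suc (Suc i)) * (fps_X * (fps_X * trinom_series a b (Suc i)))"
      by (simp add: g_def algebra_simps)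
    then show ?thesis
      unfolding G_def pw
      by (simp only: fps_add_nth fps_sub_nth fps_mult_left_const_nth trinom_series_nth X_trinom_series_nth X_X_trinom_series_nth) (simp add: add_ac)
  qed
  have "?L = g + fps_const (x ^ Suc i) * (fps_X * g)"
    unfolding g_def[symmetric] by (simp only: distrib_right mult_1 mult.assoc)
  then have "fps_nth ?L k = G (int k) + x powi (int (Suc i)) * G (int k - 1)"
    unfolding power_int_of_nat by (simp only: fps_add_nth fps_mult_left_const_nth g1 g2)
  also have "\<dots> = trinom_term (int a) (int (Suc b) - 1) (int (Suc i) - 1) (int k)
     - x powi (int (Suc b) - 1) * trinom_term (int a + 1) (int (Suc b)) (int (Suc i) - 1) (int k)"
    unfolding G_def by (rule trinom_term_contiguous) auto
  also have "\<dots> = fps_nth ?R k"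
    by (simp add: trinom_series_nth add_ac)
  finally show "fps_nth ?L k = fps_nth ?R k" .
qed

lemma trinomial_contiguous:
  "trinomial a (Suc b) (Suc i) - fps_const (x ^ b) * trinomial (Suc a) b (Suc i)
        - fps_const (x ^ (Suc b + Suc i)) * (fps_X * trinomial (Suc a) (Suc b) (Suc i))
        + fps_const (x ^ Suc (Suc i)) * (fps_X * trinomial a b (Suc i))
   = trinomial a b i - fps_const (x ^ b) * trinomial (Suc a) (Suc b) i"
proof -
  have "trinomial a (Suc b) (Suc i) - fps_const (x ^ b) * trinomial (Suc a) b (Suc i)
        - fps_const (x ^ (Suc b + Suc i)) * (fps_X * trinomial (Suc a) (Suc b) (Suc i))
        + fps_const (x ^ Suc (Suc i)) * (fps_X * trinomial a b (Suc i))
    = qprod i * ((1 + fps_const (x ^ Suc i) * fps_X)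
     * (trinom_series a (Suc b) (Suc i) - fps_const (x ^ b) * trinom_series (Suc a) b (Suc i)
        - fps_const (x ^ (Suc b + Suc i)) * (fps_X * trinom_series (Suc a) (Suc b) (Suc i))
        + fps_const (x ^ Suc (Suc i)) * (fps_X * trinom_series a b (Suc i))))"
    unfolding trinomial_def qprod_Suc by (simp only: algebra_simps)
  also have "\<dots> = trinomial a b i - fps_const (x ^ b) * trinomial (Suc a) (Suc b) i"
    unfolding trinom_series_contiguous trinomial_def by (simp only: algebra_simps)
  finally show ?thesis .
qed

text \<open>The start of the telescoping, where no level i - 1 remains on the right. The series with
  \<open>Suc b\<close> vanish because 0 - (b + 1) is negative; the other two cancel, and are nonzero
  only for b = 0.\<close>

lemma trinomial_contiguous_0:
  "trinomial a (Suc b) 0 - fps_const (x ^ b) * trinomial (Suc a) b 0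
        - fps_const (x ^ Suc b) * (fps_X * trinomial (Suc a) (Suc b) 0)
        + fps_const x * (fps_X * trinomial a b 0) = 0"
proof (rule fps_ext)
  fix k
  have z: "trinom_term a' (int (Suc b)) 0 k' = 0" for a' k'
    by (auto simp: trinom_term_def gauss_neg)
  have "x ^ b * trinom_term (int (Suc a)) (int b) 0 (int k) = x * trinom_term (int a) (int b) 0 (int k - 1)"
  proof (cases "b = 0")
    case False
    then show ?thesis by (auto simp: trinom_term_def gauss_neg)
  next
    case True
    show ?thesis
    proof (cases "even (int k - 1 - int a)")
      case True
      then obtain r where "int k - 1 - int a = 2 * r" by (elim evenE)
      then have k: "int k - 1 = int a + 2 * r" "int k = int (Suc a) + 2 * r" by simp_all
      have "gauss 0 r * gauss 0 (r + int (Suc a)) = gauss 0 r * gauss 0 (r + int a)"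
        by (cases "r \<ge> 0") (simp_all add: gauss_0_left gauss_neg)
      then show ?thesis unfolding trinom_term_even[OF k(1)] trinom_term_even[OF k(2)] \<open>b = 0\<close>
        by (simp add: powi_add mult_ac)
    qed (simp add: trinom_term_def algebra_simps)
  qed
  then show "fps_nth (trinomial a (Suc b) 0 - fps_const (x ^ b) * trinomial (Suc a) b 0
        - fps_const (x ^ Suc b) * (fps_X * trinomial (Suc a) (Suc b) 0)
        + fps_const x * (fps_X * trinomial a b 0)) k = fps_nth 0 k"
    unfolding fps_add_nth fps_sub_nth fps_mult_left_const_nth trinomial_def qprod_0 mult_1 trinom_series_nth X_trinom_series_nth
    by (simp add: z del: of_nat_Suc)
qed

lemma trinomial_pascal:
  "fps_const (x ^ b) * trinomial (Suc a) (Suc b) i = fps_const (x ^ b) * trinomial (Suc a) b i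
    + fps_const (x ^ (i + 2 * b + 1)) * (fps_X * trinomial (Suc (Suc a)) (Suc b) i)
    - fps_const (x ^ Suc i) * (fps_X * trinomial a b i)"
proof -
  have "fps_const (x ^ b) * trinom_series (Suc a) (Suc b) i = fps_const (x ^ b) * trinom_series (Suc a) b i
    + fps_const (x ^ (i + 2 * b + 1)) * (fps_X * trinom_series (Suc (Suc a)) (Suc b) i)
    - fps_const (x ^ Suc i) * (fps_X * trinom_series a b i)" (is "?l = ?r")
  proof (rule fps_ext)
    fix k
    have pw: "x powi (int i + 2 * int (Suc b) - 1) = x ^ (i + 2 * b + 1)" "x powi (int i + 1) = x ^ Suc i"
      "x powi (int (Suc b) - 1) = x ^ b"
      unfolding power_int_of_nat[symmetric] by (rule arg_cong[where f = "power_int x"]; simp)+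
    show "fps_nth ?l k = fps_nth ?r k"
      using trinom_term_pascal[of "int (Suc b)" "int i" "int (Suc a)" "int k"]
      unfolding fps_add_nth fps_sub_nth fps_mult_left_const_nth trinom_series_nth X_trinom_series_nth pw
      by (simp add: add_ac)
  qed
  then have "qprod i * ?l = qprod i * ?r" by simp
  then show ?thesis unfolding trinomial_def by (simp only: algebra_simps)
qed

section \<open>Abel summation and Warnaar's transformation\<close>

definition trinom_coeff :: "nat \<Rightarrow> nat \<Rightarrow> nat \<Rightarrow> nat \<Rightarrow> 'a" where
  "trinom_coeff a b i L = fps_nth (fps_X ^ i * trinomial a b i) L"

lemma qprod_nth: "fps_nth (qprod i) n = x ^ tri n * qbin i n"
  using prod_linear_nth[of 1 i n] by (simp add: qprod_def)

lemma trinomial_nth: "fps_nth (trinomial a b i) L = (\<Sum>n\<le>i. x ^ tri n * qbin i n * trinom_term a b i (int L - int n))"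
proof -
  have "fps_nth (trinomial a b i) L = (\<Sum>n\<le>L. x ^ tri n * qbin i n * trinom_term a b i (int L - int n))"
    unfolding trinomial_def fps_mult_nth qprod_nth trinom_series_nth atLeast0AtMost
    by (intro sum.cong) (auto simp: of_nat_diff)
  also have "\<dots> = (\<Sum>n\<le>i. x ^ tri n * qbin i n * trinom_term a b i (int L - int n))"
    by (rule sum.mono_neutral_cong) (auto simp: qbin_zero trinom_term_less)
  finally show ?thesis .
qed

text \<open>The factor \<open>fps_X ^ i\<close> realises the first argument L - i of T. For i > L
  the coefficient is 0, and on the right every index is negative, hence below a.\<close>

lemma trinom_coeff_eq: "trinom_coeff a b i L = (\<Sum>n\<le>i. x ^ tri n * qbin i n * trinom_term a b i (int L - int i - int n))"
proof (cases "i \<le> L")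
  case True
  then show ?thesis
    by (simp add: trinom_coeff_def fps_X_power_mult_nth trinomial_nth of_nat_diff)
next
  case False
  then show ?thesis
    by (simp add: trinom_coeff_def fps_X_power_mult_nth trinom_term_less)
qed

text \<open>
  Applied with \<open>w i = gauss (M - i) L\<close> for \<open>level\<close> and with \<open>w = 1\<close> for its limit \<open>M \<rightarrow> \<infinity>\<close>, \<open>level_inf\<close>.
\<close>

lemma trinom_coeff_abel_sum:
  fixes w :: "nat \<Rightarrow> 'a" and a b L K :: nat
  defines "D \<equiv> \<lambda>i. x ^ Suc b * trinom_coeff (Suc a) (Suc b) i L - x * trinom_coeff a b i L"
  shows "(\<Sum>i\<le>K. x ^ tri i * w i * (trinom_coeff a (Suc b) i (Suc L) - x ^ b * trinom_coeff (Suc a) b i (Suc L)))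
    = (\<Sum>i\<le>K. x ^ (tri i + i) * (w i - w (Suc i)) * D i) + x ^ (tri K + K) * w (Suc K) * D K"
proof (induction K)
  case 0
  have "fps_nth (trinomial a (Suc b) 0 - fps_const (x ^ b) * trinomial (Suc a) b 0
        - fps_const (x ^ Suc b) * (fps_X * trinomial (Suc a) (Suc b) 0)
        + fps_const x * (fps_X * trinomial a b 0)) (Suc L) = 0"
    unfolding trinomial_contiguous_0 by simp
  then have "trinom_coeff a (Suc b) 0 (Suc L) - x ^ b * trinom_coeff (Suc a) b 0 (Suc L) = D 0"
    by (simp add: trinom_coeff_def D_def algebra_simps)
  then show ?case by (simp add: algebra_simps)
next
  case (Suc K)
  have "fps_X ^ Suc K * (trinomial a (Suc b) (Suc K) - fps_const (x ^ b) * trinomial (Suc a) b (Suc K)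
        - fps_const (x ^ (Suc b + Suc K)) * (fps_X * trinomial (Suc a) (Suc b) (Suc K))
        + fps_const (x ^ Suc (Suc K)) * (fps_X * trinomial a b (Suc K)))
     = fps_X ^ Suc K * (trinomial a b K - fps_const (x ^ b) * trinomial (Suc a) (Suc b) K)"
    unfolding trinomial_contiguous ..
  then have "fps_X ^ Suc K * trinomial a (Suc b) (Suc K) - fps_const (x ^ b) * (fps_X ^ Suc K * trinomial (Suc a) b (Suc K))
        - fps_const (x ^ (Suc b + Suc K)) * (fps_X * (fps_X ^ Suc K * trinomial (Suc a) (Suc b) (Suc K)))
        + fps_const (x ^ Suc (Suc K)) * (fps_X * (fps_X ^ Suc K * trinomial a b (Suc K)))
     = fps_X * (fps_X ^ K * trinomial a b K) - fps_const (x ^ b) * (fps_X * (fps_X ^ K * trinomial (Suc a) (Suc b) K))"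
    by (simp only: algebra_simps power_Suc)
  from arg_cong[OF this, of "\<lambda>F. fps_nth F (Suc L)"]
  have "trinom_coeff a (Suc b) (Suc K) (Suc L) - x ^ b * trinom_coeff (Suc a) b (Suc K) (Suc L)
      - x ^ (Suc b + Suc K) * trinom_coeff (Suc a) (Suc b) (Suc K) L + x ^ Suc (Suc K) * trinom_coeff a b (Suc K) L
      = trinom_coeff a b K L - x ^ b * trinom_coeff (Suc a) (Suc b) K L"
    unfolding fps_add_nth fps_sub_nth fps_mult_left_const_nth trinom_coeff_def
    by (simp only: fps_X_mult_nth nat.distinct if_False diff_Suc_1)
  then have "x * (trinom_coeff a (Suc b) (Suc K) (Suc L) - x ^ b * trinom_coeff (Suc a) b (Suc K) (Suc L)
      - x ^ (Suc b + Suc K) * trinom_coeff (Suc a) (Suc b) (Suc K) L + x ^ Suc (Suc K) * trinom_coeff a b (Suc K) L)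
      = x * (trinom_coeff a b K L - x ^ b * trinom_coeff (Suc a) (Suc b) K L)"
    by (rule arg_cong)
  \<comment> \<open>\<open>D\<close> is built for this: the contiguous relation becomes a weighted
    difference of its values at K + 1 and K, and the factor \<open>x ^ (tri K + K)\<close> makes
    consecutive weights match.\<close>
  then have "x * (trinom_coeff a (Suc b) (Suc K) (Suc L) - x ^ b * trinom_coeff (Suc a) b (Suc K) (Suc L))
     = x * x ^ Suc K * D (Suc K) - D K"
    unfolding D_def by (simp add: power_add algebra_simps)
  then have "x ^ (tri K + K) * w (Suc K) * (x * (trinom_coeff a (Suc b) (Suc K) (Suc L) - x ^ b * trinom_coeff (Suc a) b (Suc K) (Suc L)))
     = x ^ (tri K + K) * w (Suc K) * (x * x ^ Suc K * D (Suc K) - D K)"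
    by simp
  then have "x ^ tri (Suc K) * w (Suc K) * (trinom_coeff a (Suc b) (Suc K) (Suc L) - x ^ b * trinom_coeff (Suc a) b (Suc K) (Suc L))
     = x ^ (tri (Suc K) + Suc K) * w (Suc K) * D (Suc K) - x ^ (tri K + K) * w (Suc K) * D K"
    by (simp add: tri_Suc power_add algebra_simps)
  then show ?case
    unfolding sum.atMost_Suc Suc.IH by (simp add: algebra_simps)
qed

definition level :: "nat \<Rightarrow> nat \<Rightarrow> nat \<Rightarrow> nat \<Rightarrow> 'a" where
  "level a b L M = (\<Sum>i\<le>M. x ^ tri i * gauss (int M - int i) (int L) * trinom_coeff a b i L)"

text \<open>Abel summation leaves differences of \<open>w\<close>, which by Pascal's rule are
  \<open>x ^ (M - i)\<close> times binomials with L in place of \<open>Suc L\<close>. The power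
  \<open>x ^ i\<close> from the telescoping completes this to \<open>x ^ M\<close>, independent of
  i, so the sums are levels again.\<close>

lemma level_Suc:
  "level a (Suc b) (Suc L) M = x ^ b * level (Suc a) b (Suc L) M
     + x ^ M * (x ^ Suc b * level (Suc a) (Suc b) L M - x * level a b L M)"
proof -
  define w where "w = (\<lambda>i. gauss (int M - int i) (int (Suc L)))"
  have w: "x ^ i * (w i - w (Suc i)) = x ^ M * gauss (int M - int i) (int L)" if "i \<le> M" for i
  proof -
    have "w i = w (Suc i) + x ^ (M - i) * gauss (int M - int i) (int L)"
    proof -
      have e: "int M - int i = int (M - i)" "int M - int (Suc i) = int (M - i) - 1"
        using that by simp_all
      show ?thesis
        unfolding w_def e using gauss_pascal[of "int (M - i)" "int (Suc L)"] by simp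
    qed
    then have "x ^ i * (w i - w (Suc i)) = (x ^ i * x ^ (M - i)) * gauss (int M - int i) (int L)" by simp
    with that show ?thesis by (simp flip: power_add)
  qed
  have w0: "w (Suc M) = 0" by (simp add: w_def gauss_neg)
  have "level a (Suc b) (Suc L) M - x ^ b * level (Suc a) b (Suc L) M
     = (\<Sum>i\<le>M. x ^ tri i * w i * (trinom_coeff a (Suc b) i (Suc L) - x ^ b * trinom_coeff (Suc a) b i (Suc L)))"
    unfolding level_def w_def sum_distrib_left sum_subtractf[symmetric]
    by (intro sum.cong) (simp_all add: algebra_simps)
  also have "\<dots> = (\<Sum>i\<le>M. x ^ tri i * (x ^ i * (w i - w (Suc i))) * (x ^ Suc b * trinom_coeff (Suc a) (Suc b) i L - x * trinom_coeff a b i L))"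
    unfolding trinom_coeff_abel_sum w0 by (simp add: power_add mult_ac)
  also have "\<dots> = (\<Sum>i\<le>M. x ^ tri i * (x ^ M * gauss (int M - int i) (int L)) * (x ^ Suc b * trinom_coeff (Suc a) (Suc b) i L - x * trinom_coeff a b i L))"
    by (intro sum.cong) (simp_all add: w)
  also have "\<dots> = x ^ M * (x ^ Suc b * level (Suc a) (Suc b) L M - x * level a b L M)"
    unfolding level_def sum_distrib_left sum_subtractf[symmetric]
    by (intro sum.cong) (simp_all add: algebra_simps)
  finally show ?thesis by (simp add: algebra_simps)
qed

text \<open>As M grows, \<open>gauss (M - i) L\<close> tends formally to
  \<open>1 / q_poch x L\<close>, a factor independent of i that is left out here. Terms with i > L
  vanish, hence the range.\<close>

definition level_inf :: "nat \<Rightarrow> nat \<Rightarrow> nat \<Rightarrow> 'a" where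
  "level_inf a b L = (\<Sum>i\<le>L. x ^ tri i * trinom_coeff a b i L)"

lemma trinom_coeff_less: "L < i \<Longrightarrow> trinom_coeff a b i L = 0"
  by (simp add: trinom_coeff_def fps_X_power_mult_nth)

lemma trinom_coeff_0: "trinom_coeff a (Suc b) i 0 = 0"
  by (cases i) (simp_all add: trinom_coeff_def trinomial_def trinom_series_nth trinom_term_def gauss_neg)

text \<open>For constant weights the differences in the Abel sum are 0, and its boundary term
  contains coefficients of index L - 1 at level i = L, which vanish.\<close>

lemma level_inf_Suc: "level_inf a (Suc b) L = x ^ b * level_inf (Suc a) b L"
proof (cases L)
  case 0
  have "level_inf (Suc a) b 0 = 0" by (simp add: level_inf_def trinom_coeff_def trinomial_def trinom_series_nth trinom_term_less)
  moreover have "level_inf a (Suc b) 0 = 0" by (simp add: level_inf_def trinom_coeff_0)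
  ultimately show ?thesis using 0 by simp
next
  case (Suc l)
  have "level_inf a (Suc b) L - x ^ b * level_inf (Suc a) b L
    = (\<Sum>i\<le>L. x ^ tri i * 1 * (trinom_coeff a (Suc b) i (Suc l) - x ^ b * trinom_coeff (Suc a) b i (Suc l)))"
    unfolding level_inf_def Suc sum_distrib_left sum_subtractf[symmetric]
    by (intro sum.cong) (simp_all add: algebra_simps)
  also have "\<dots> = 0"
    unfolding trinom_coeff_abel_sum[where w = "\<lambda>_. 1"] by (simp add: Suc trinom_coeff_less)
  finally show ?thesis by simp
qed

text \<open>Lowering b to 0 collects the exponents b - 1, ..., 1, 0. At b = 0 truncated subtraction
  gives the correct exponent \<open>tri 0\<close>.\<close>

lemma level_inf_eq: "level_inf a b L = x ^ tri (b - 1) * level_inf (a + b) 0 L"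
proof (induction b arbitrary: a)
  case (Suc b)
  show ?case
    unfolding level_inf_Suc Suc by (cases b) (simp_all add: tri_Suc power_add mult_ac)
qed simp

text \<open>
  Grouping by \<open>d = i - n\<close>, where \<open>n\<close> is the summation index inside \<open>trinom_coeff\<close>, leaves a single
  hypergeometric sum over \<open>k = n\<close>.
\<close>

lemma sum_trinom_coeff_0:
  fixes w :: "nat \<Rightarrow> 'a"
  shows "(\<Sum>i\<le>K. x ^ tri i * w i * trinom_coeff a 0 i L) = (\<Sum>d\<le>K.
     if even (int L - int d - int a) \<and> d + a \<le> L then
       let u = (L - d - a) div 2 in x ^ (tri d + u + a) * qbin (u + d) d *
         (\<Sum>k\<le>K - d. x ^ (k * (k + d)) * qbin u k * qbin (u + a + d) (d + k) * w (d + k))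
     else 0)"
proof -
  define f where "f = (\<lambda>d k. x ^ tri (d + k) * w (d + k) * (x ^ tri k * qbin (d + k) k * trinom_term a 0 (d + k) (int L - int d - 2 * int k)))"
  have "(\<Sum>i\<le>K. x ^ tri i * w i * trinom_coeff a 0 i L) = (\<Sum>i\<le>K. \<Sum>n\<le>i. f (i - n) n)"
    unfolding trinom_coeff_eq sum_distrib_left f_def by (intro sum.cong refl) (simp add: of_nat_diff algebra_simps)
  also have "\<dots> = (\<Sum>d\<le>K. \<Sum>k\<le>K - d. f d k)"
    unfolding sum.Sigma[OF finite_atMost ballI[OF finite_atMost]]
    by (rule sum.reindex_bij_witness[of _ "\<lambda>(d, k). (d + k, k)" "\<lambda>(i, n). (i - n, n)"]) auto
  also have "\<dots> = (\<Sum>d\<le>K. if even (int L - int d - int a) \<and> d + a \<le> L then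
       let u = (L - d - a) div 2 in x ^ (tri d + u + a) * qbin (u + d) d *
         (\<Sum>k\<le>K - d. x ^ (k * (k + d)) * qbin u k * qbin (u + a + d) (d + k) * w (d + k))
     else 0)"
  proof (rule sum.cong[OF refl])
    fix d
    show "(\<Sum>k\<le>K - d. f d k) = (if even (int L - int d - int a) \<and> d + a \<le> L then
       let u = (L - d - a) div 2 in x ^ (tri d + u + a) * qbin (u + d) d *
         (\<Sum>k\<le>K - d. x ^ (k * (k + d)) * qbin u k * qbin (u + a + d) (d + k) * w (d + k))
     else 0)"
    proof (cases "even (int L - int d - int a) \<and> d + a \<le> L")
      case False
      have "trinom_term a 0 (d + k) (int L - int d - 2 * int k) = 0" for k
        using False by (cases "d + a \<le> L") (auto simp: trinom_term_less intro!: trinom_term_odd)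
      then show ?thesis unfolding if_not_P[OF False] by (simp add: f_def)
    next
      case True
      then have "even (L - d - a)" by (auto simp flip: of_nat_diff simp: even_of_nat_iff)
      then obtain u where "L - d - a = 2 * u" by (elim evenE)
      with conjunct2[OF True] have L: "L = d + a + 2 * u" by linarith
      have u: "(L - d - a) div 2 = u" by (simp add: L)
      have "f d k = x ^ (tri d + u + a) * qbin (u + d) d * (x ^ (k * (k + d)) * qbin u k * qbin (u + a + d) (d + k) * w (d + k))" for k
      proof (cases "k \<le> u")
        case False
        then have "trinom_term a 0 (d + k) (int L - int d - 2 * int k) = 0"
          by (intro trinom_term_less) (simp add: L)
        with False show ?thesis by (simp add: f_def qbin_zero)
      next
        case True
        have y: "trinom_term a 0 (d + k) (int L - int d - 2 * int k)
           = x ^ (u - k + a) * qbin (u + d) (d + k) * qbin (u + a + d) (d + k)"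
        proof -
          have kk: "int L - int d - 2 * int k = int a + 2 * int (u - k)"
            using True by (simp add: L of_nat_diff)
          have "trinom_term a 0 (d + k) (int L - int d - 2 * int k)
            = x powi (int (u - k) + int a) * gauss (int (d + k) + 0) (int (u - k)) * gauss (int (d + k) - 0) (int (u - k) + int a)"
            by (rule trinom_term_even[OF kk])
          then have "trinom_term a 0 (d + k) (int L - int d - 2 * int k)
            = x powi (int (u - k + a)) * gauss (int (d + k)) (int (u - k)) * gauss (int (d + k)) (int (u - k + a))"
            by (simp only: add_0_right diff_0_right of_nat_add[symmetric])
          also have "gauss (int (d + k)) (int (u - k)) = qbin (u + d) (d + k)"
            unfolding qbin_eq_gauss by (subst gauss_commute) (use True in \<open>simp add: of_nat_diff\<close>)
          also have "gauss (int (d + k)) (int (u - k + a)) = qbin (u + a + d) (d + k)"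
            unfolding qbin_eq_gauss by (subst gauss_commute) (use True in \<open>simp add: of_nat_diff algebra_simps\<close>)
          finally show ?thesis by (simp only: power_int_of_nat)
        qed
        have e: "x ^ tri (d + k) * x ^ tri k * x ^ (u - k + a) = x ^ (tri d + u + a) * x ^ (k * (k + d))"
        proof -
          have "tri (d + k) + tri k + (u - k + a) = tri d + u + a + k * (k + d)"
            using two_tri[of k] True by (simp add: tri_add algebra_simps)
          then show ?thesis unfolding power_add[symmetric] by (rule arg_cong)
        qed
        have q: "qbin (d + k) k * qbin (u + d) (d + k) = qbin (u + d) d * qbin u k"
          using qbin_mult_qbin[of "u + d" d k] qbin_sym[of k "d + k"] by (simp add: mult.commute)
        have "f d k = (x ^ tri (d + k) * x ^ tri k * x ^ (u - k + a)) * (qbin (d + k) k * qbin (u + d) (d + k)) * qbin (u + a + d) (d + k) * w (d + k)"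
          unfolding f_def y by (simp only: mult_ac)
        then show ?thesis unfolding e q by (simp only: mult_ac)
      qed
      then show ?thesis unfolding if_P[OF True] Let_def u sum_distrib_left by simp
    qed
  qed
  finally show ?thesis .
qed

text \<open>The two sides agree for each d separately: the sum over k is
  \<open>qbin_Saalschuetz\<close> with v = u + a, and trinomial revision recombines the
  prefactors.\<close>

lemma level_0: "level a 0 L M = fps_nth (trinomial a 0 M) L"
  unfolding level_def sum_trinom_coeff_0 trinomial_nth
proof (rule sum.cong[OF refl])
  fix d assume d: "d \<in> {..M}"
  show "(if even (int L - int d - int a) \<and> d + a \<le> L then
       let u = (L - d - a) div 2 in x ^ (tri d + u + a) * qbin (u + d) d *
         (\<Sum>k\<le>M - d. x ^ (k * (k + d)) * qbin u k * qbin (u + a + d) (d + k) * gauss (int M - int (d + k)) (int L))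
     else 0) = x ^ tri d * qbin M d * trinom_term a (int 0) M (int L - int d)"
  proof (cases "even (int L - int d - int a) \<and> d + a \<le> L")
    case False
    then have "trinom_term a (int 0) M (int L - int d) = 0"
      by (cases "d + a \<le> L") (auto simp: trinom_term_less intro!: trinom_term_odd)
    then show ?thesis unfolding if_not_P[OF False] by simp
  next
    case True
    then have "even (L - d - a)" by (auto simp flip: of_nat_diff simp: even_of_nat_iff)
    then obtain u where "L - d - a = 2 * u" by (elim evenE)
    with conjunct2[OF True] have L: "L = d + a + 2 * u" by linarith
    have u: "(L - d - a) div 2 = u" by (simp add: L)
    \<comment> \<open>The ranges differ only by zero terms: beyond M - d the factor
      \<open>gauss\<close> has a negative argument, beyond u + a the second \<open>qbin\<close>
      vanishes.\<close>
    have "(\<Sum>k\<le>M - d. x ^ (k * (k + d)) * qbin u k * qbin (u + a + d) (d + k) * gauss (int M - int (d + k)) (int L))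
      = (\<Sum>k\<le>u + a. x ^ (k * (k + d)) * qbin u k * qbin (u + a + d) (d + k) * gauss (int M - int d - int k) (int (u + (u + a) + d)))"
      by (rule sum.mono_neutral_cong) (use d in \<open>auto simp: qbin_zero gauss_neg L algebra_simps\<close>)
    also have "\<dots> = gauss (int M - int d) (int (u + d)) * qbin (M + (u + a)) (u + a)"
      by (rule qbin_Saalschuetz[symmetric])
    finally have s: "(\<Sum>k\<le>M - d. x ^ (k * (k + d)) * qbin u k * qbin (u + a + d) (d + k) * gauss (int M - int (d + k)) (int L))
       = qbin (M + u) (u + d) * qbin (M + (u + a)) (u + a)"
      by (simp add: qbin_eq_gauss)
    have q: "qbin (u + d) d * qbin (M + u) (u + d) = qbin M d * qbin (M + u) u"
      using qbin_mult_qbin[of "M + u" u d] qbin_sym[of d "u + d"] by (simp add: mult.commute)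
    have "int L - int d = int a + 2 * int u" by (simp add: L)
    from trinom_term_even[OF this] have y: "trinom_term a (int 0) M (int L - int d) = x ^ (u + a) * qbin (M + u) u * qbin (M + (u + a)) (u + a)"
      by (simp only: of_nat_0 add_0_right diff_0_right of_nat_add[symmetric] power_int_of_nat gauss_eq_qbin)
    have "(if even (int L - int d - int a) \<and> d + a \<le> L then
       let u = (L - d - a) div 2 in x ^ (tri d + u + a) * qbin (u + d) d *
         (\<Sum>k\<le>M - d. x ^ (k * (k + d)) * qbin u k * qbin (u + a + d) (d + k) * gauss (int M - int (d + k)) (int L))
     else 0) = x ^ (tri d + u + a) * qbin (u + d) d * (qbin (M + u) (u + d) * qbin (M + (u + a)) (u + a))"
      unfolding if_P[OF True] Let_def u s by simp
    also have "\<dots> = x ^ (tri d + u + a) * (qbin (u + d) d * qbin (M + u) (u + d)) * qbin (M + (u + a)) (u + a)"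
      by (simp only: mult_ac)
    finally show ?thesis unfolding q y by (simp add: power_add mult_ac)
  qed
qed

text \<open>Induction on L and, inside it, on b, with a free: \<open>level_Suc\<close> leads to (a +
  1, b) at the same L and to two levels at smaller L, and \<open>trinomial_pascal\<close> supplies
  the same recurrence for the right side.\<close>

lemma level_eq: "level a b L M = x ^ tri (b - 1) * fps_nth (trinomial (a + b) b M) L"
proof (induction L arbitrary: a b)
  case 0
  show ?case
  proof (cases b)
    case 0
    then show ?thesis by (simp add: level_0)
  next
    case (Suc b')
    then show ?thesis by (simp add: level_def trinom_coeff_0 trinomial_def trinom_series_nth trinom_term_less)
  qed
next
  case (Suc L)
  note IH = this
  show ?case
  proof (induction b arbitrary: a)
    case 0
    show ?case by (simp add: level_0)
  next
    case (Suc b)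
    have tb: "x ^ tri b = x ^ tri (b - 1) * x ^ b"
      by (cases b) (simp_all add: tri_Suc power_add)
    from arg_cong[OF trinomial_pascal[of b "a + b" M], of "\<lambda>F. fps_nth F (Suc L)"]
    have p: "x ^ b * fps_nth (trinomial (Suc (a + b)) (Suc b) M) (Suc L)
      = x ^ b * fps_nth (trinomial (Suc (a + b)) b M) (Suc L)
        + x ^ (M + 2 * b + 1) * fps_nth (trinomial (Suc (Suc (a + b))) (Suc b) M) L
        - x ^ Suc M * fps_nth (trinomial (a + b) b M) L"
      unfolding fps_add_nth fps_sub_nth fps_mult_left_const_nth
      by (simp only: fps_X_mult_nth nat.distinct if_False diff_Suc_1)
    have e: "x ^ M * (x ^ Suc b * (x ^ tri (b - 1) * x ^ b)) = x ^ tri (b - 1) * x ^ (M + 2 * b + 1)"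
      unfolding power_add[symmetric] by (rule arg_cong[where f = "power x"]) simp
    have "level a (Suc b) (Suc L) M = x ^ b * (x ^ tri (b - 1) * fps_nth (trinomial (Suc (a + b)) b M) (Suc L))
      + x ^ M * (x ^ Suc b * (x ^ tri b * fps_nth (trinomial (Suc (Suc (a + b))) (Suc b) M) L)
                 - x * (x ^ tri (b - 1) * fps_nth (trinomial (a + b) b M) L))"
      unfolding level_Suc Suc.IH IH by simp
    also have "\<dots> = x ^ tri (b - 1) * (x ^ b * fps_nth (trinomial (Suc (a + b)) b M) (Suc L))
      + (x ^ M * (x ^ Suc b * (x ^ tri (b - 1) * x ^ b))) * fps_nth (trinomial (Suc (Suc (a + b))) (Suc b) M) L
                 - x ^ tri (b - 1) * (x ^ Suc M * fps_nth (trinomial (a + b) b M) L)"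
      unfolding tb by (simp add: algebra_simps)
    also have "\<dots> = x ^ tri (b - 1) * (x ^ b * fps_nth (trinomial (Suc (a + b)) (Suc b) M) (Suc L))"
      unfolding p e by (simp add: algebra_simps)
    finally show ?case by (simp add: tb mult_ac)
  qed
qed

section \<open>The sums over N_1 and i\<close>

lemma level_inf_0: "level_inf a 0 L = (\<Sum>d\<le>L. if even (int L - int d - int a) \<and> d + a \<le> L then
       let u = (L - d - a) div 2 in x ^ (tri d + u + a) * qbin (u + d) d * qbin L (u + d)
     else 0)"
proof -
  have "level_inf a 0 L = (\<Sum>i\<le>L. x ^ tri i * 1 * trinom_coeff a 0 i L)"
    by (simp add: level_inf_def)
  also have "\<dots> = (\<Sum>d\<le>L. if even (int L - int d - int a) \<and> d + a \<le> L then
       let u = (L - d - a) div 2 in x ^ (tri d + u + a) * qbin (u + d) d * qbin L (u + d)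
     else 0)"
    unfolding sum_trinom_coeff_0[where w = "\<lambda>_. 1"]
  proof (intro sum.cong refl if_cong)
    fix d assume "even (int L - int d - int a) \<and> d + a \<le> L"
    then have "even (L - d - a)" "d + a \<le> L" by (auto simp flip: of_nat_diff simp: even_of_nat_iff)
    moreover from this obtain u where "L - d - a = 2 * u" by (elim evenE)
    ultimately have L: "L = d + a + 2 * u" by linarith
    have u: "(L - d - a) div 2 = u" by (simp add: L)
    have "(\<Sum>k\<le>L - d. x ^ (k * (k + d)) * qbin u k * qbin (u + a + d) (d + k) * 1)
       = (\<Sum>k\<le>u. x ^ (k * (k + d)) * qbin u k * qbin (u + a + d) (d + k))"
      by (rule sum.mono_neutral_cong) (auto simp: L qbin_zero)
    also have "\<dots> = qbin L (u + d)"
      using qbin_Vandermonde'[of u "u + a + d" d] by (simp add: L add_ac mult_2)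
    finally show "(let u = (L - d - a) div 2 in x ^ (tri d + u + a) * qbin (u + d) d *
         (\<Sum>k\<le>L - d. x ^ (k * (k + d)) * qbin u k * qbin (u + a + d) (d + k) * 1))
      = (let u = (L - d - a) div 2 in x ^ (tri d + u + a) * qbin (u + d) d * qbin L (u + d))"
      unfolding Let_def u by simp
  qed
  finally show ?thesis .
qed

text \<open>In the coordinates u = (i - d - a) / 2 and p = u + d the parity condition disappears,
  and the binomials become \<open>qbin M p\<close>, \<open>qbin p u\<close> and
  \<open>qbin (M - p) (a + u)\<close>. Vandermonde then sums over u, and once more over p.\<close>

lemma sum_level_inf_0:
  "(\<Sum>i\<le>M. x ^ tri (i - 1) * qbin M i * level_inf a 0 i) = x ^ tri a * qbin (2 * M) (M + a)"
proof -
  define f where "f = (\<lambda>i d. x ^ tri (i - 1) * qbin M i * (let u = (i - d - a) div 2 in x ^ (tri d + u + a) * qbin (u + d) d * qbin i (u + d)))"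
  define S where "S = (SIGMA i:{..M}. {d. even (int i - int d - int a) \<and> d + a \<le> i})"
  have "(\<Sum>i\<le>M. x ^ tri (i - 1) * qbin M i * level_inf a 0 i)
    = (\<Sum>i\<le>M. \<Sum>d\<le>i. if d \<in> {d. even (int i - int d - int a) \<and> d + a \<le> i} then f i d else 0)"
    unfolding level_inf_0 sum_distrib_left f_def by (intro sum.cong refl) simp
  also have "\<dots> = (\<Sum>i\<le>M. \<Sum>d\<in>{d. even (int i - int d - int a) \<and> d + a \<le> i}. f i d)"
  proof (rule sum.cong[OF refl])
    fix i
    have "{..i} \<inter> {d. even (int i - int d - int a) \<and> d + a \<le> i} = {d. even (int i - int d - int a) \<and> d + a \<le> i}"
      by auto
    then show "(\<Sum>d\<le>i. if d \<in> {d. even (int i - int d - int a) \<and> d + a \<le> i} then f i d else 0)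
      = (\<Sum>d\<in>{d. even (int i - int d - int a) \<and> d + a \<le> i}. f i d)"
      by (simp only: sum.inter_restrict[symmetric] finite_atMost)
  qed
  also have "\<dots> = (\<Sum>(i, d)\<in>S. f i d)"
    unfolding S_def
  proof (rule sum.Sigma)
    show "\<forall>i\<in>{..M}. finite {d. even (int i - int d - int a) \<and> d + a \<le> i}"
      by (auto intro: finite_subset[of _ "{..M}"])
  qed simp
  also have "\<dots> = (\<Sum>(p, u)\<in>{(p, u). u \<le> p \<and> p + u + a \<le> M}. f (p + u + a) (p - u))"
    unfolding S_def
  proof (rule sum.reindex_bij_witness[of _ "\<lambda>(p, u). (p + u + a, p - u)" "\<lambda>(i, d). ((i + d - a) div 2, (i - d - a) div 2)"], goal_cases)
    case (1 z)
    then obtain i d where z: "z = (i, d)" and *: "i \<le> M" "even (int i - int d - int a)" "d + a \<le> i" by auto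
    then have "even (i - d - a)" by (auto simp flip: of_nat_diff simp: even_of_nat_iff)
    then obtain u where "i - d - a = 2 * u" by (elim evenE)
    with * have "i = d + a + 2 * u" by linarith
    then show ?case by (simp add: z)
  next
    case (2 z)
    then obtain i d where z: "z = (i, d)" and *: "i \<le> M" "even (int i - int d - int a)" "d + a \<le> i" by auto
    then have "even (i - d - a)" by (auto simp flip: of_nat_diff simp: even_of_nat_iff)
    then obtain u where "i - d - a = 2 * u" by (elim evenE)
    with * have "i = d + a + 2 * u" by linarith
    then show ?case using *(1) by (simp add: z)
  next
    case (3 z)
    then show ?case by (auto simp: le_iff_add)
  next
    case (4 z)
    then show ?case by (auto simp: le_iff_add)
  next
    case (5 z)
    then obtain i d where z: "z = (i, d)" and *: "i \<le> M" "even (int i - int d - int a)" "d + a \<le> i" by auto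
    then have "even (i - d - a)" by (auto simp flip: of_nat_diff simp: even_of_nat_iff)
    then obtain u where "i - d - a = 2 * u" by (elim evenE)
    with * have "i = d + a + 2 * u" by linarith
    then have "(i + d - a) div 2 = d + u" "(i - d - a) div 2 = u" "d + u + u + a = i" by simp_all
    then show ?case by (simp add: z)
  qed
  also have "\<dots> = (\<Sum>(p, u)\<in>{(p, u). u \<le> p \<and> p + u + a \<le> M}.
      x ^ tri a * (x ^ (p * (p + a)) * qbin M p * (x ^ (u * (u + a)) * qbin p u * qbin (M - p) (a + u))))"
  proof (rule sum.cong[OF refl], clarify)
    fix p u assume "u \<le> p" "p + u + a \<le> M"
    then obtain d where p: "p = u + d" by (auto simp: le_iff_add)
    have e: "tri (p + u + a - 1) + (tri d + u + a) = tri a + p * (p + a) + u * (u + a)"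
    proof (cases "p + u + a")
      case 0
      then show ?thesis by (simp add: p)
    next
      case (Suc n)
      have "tri (p + u + a) = tri n + (p + u + a)" by (simp add: Suc tri_Suc)
      moreover have "2 * tri (p + u + a) = (p + u + a) * (p + u + a + 1)" by (rule two_tri)
      moreover have "2 * tri d = d * (d + 1)" "2 * tri a = a * (a + 1)" by (rule two_tri)+
      ultimately have "2 * (tri n + (tri d + u + a)) = 2 * (tri a + p * (p + a) + u * (u + a))"
        by (simp add: p algebra_simps)
      then show ?thesis by (simp add: Suc)
    qed
    have q: "qbin M (p + u + a) * qbin (p + u + a) p = qbin M p * qbin (M - p) (a + u)"
      using qbin_mult_qbin[of M p "u + a"] by (simp add: add_ac)
    have d: "p - u = d" "(p + u + a - d - a) div 2 = u" by (simp_all add: p)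
    have s: "qbin p d = qbin p u" using qbin_sym[of u p] by (simp add: p)
    have "f (p + u + a) (p - u) = x ^ tri (p + u + a - 1) * qbin M (p + u + a) * (x ^ (tri d + u + a) * qbin p u * qbin (p + u + a) p)"
      unfolding f_def d Let_def p[symmetric] s ..
    also have "\<dots> = x ^ (tri (p + u + a - 1) + (tri d + u + a)) * (qbin M (p + u + a) * qbin (p + u + a) p) * qbin p u"
      by (simp only: power_add mult_ac)
    finally show "f (p + u + a) (p - u) = x ^ tri a * (x ^ (p * (p + a)) * qbin M p * (x ^ (u * (u + a)) * qbin p u * qbin (M - p) (a + u)))"
      unfolding e q by (simp only: power_add mult_ac)
  qed
  also have "\<dots> = (\<Sum>(p, u)\<in>(SIGMA p:{..M}. {..p}).
      x ^ tri a * (x ^ (p * (p + a)) * qbin M p * (x ^ (u * (u + a)) * qbin p u * qbin (M - p) (a + u))))"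
  proof (rule sum.mono_neutral_left)
    show "\<forall>z\<in>(SIGMA p:{..M}. {..p}) - {(p, u). u \<le> p \<and> p + u + a \<le> M}.
        (case z of (p, u) \<Rightarrow> x ^ tri a * (x ^ (p * (p + a)) * qbin M p * (x ^ (u * (u + a)) * qbin p u * qbin (M - p) (a + u)))) = 0"
    proof
      fix z assume "z \<in> (SIGMA p:{..M}. {..p}) - {(p, u). u \<le> p \<and> p + u + a \<le> M}"
      then obtain p u where z: "z = (p, u)" and "p \<le> M" "\<not> p + u + a \<le> M" by auto
      then have "qbin (M - p) (a + u) = 0" by (intro qbin_zero) simp
      then show "(case z of (p, u) \<Rightarrow> x ^ tri a * (x ^ (p * (p + a)) * qbin M p * (x ^ (u * (u + a)) * qbin p u * qbin (M - p) (a + u)))) = 0"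
        by (simp add: z)
    qed
  qed auto
  also have "\<dots> = (\<Sum>p\<le>M. \<Sum>u\<le>p. x ^ tri a * (x ^ (p * (p + a)) * qbin M p * (x ^ (u * (u + a)) * qbin p u * qbin (M - p) (a + u))))"
    by (rule sum.Sigma[symmetric]) auto
  also have "\<dots> = (\<Sum>p\<le>M. x ^ tri a * (x ^ (p * (p + a)) * qbin M p * qbin M (a + p)))"
  proof (rule sum.cong[OF refl])
    fix p assume "p \<in> {..M}"
    then have "qbin M (a + p) = (\<Sum>u\<le>p. x ^ (u * (u + a)) * qbin p u * qbin (M - p) (a + u))"
      using qbin_Vandermonde'[of p "M - p" a] by (simp add: add_ac)
    then show "(\<Sum>u\<le>p. x ^ tri a * (x ^ (p * (p + a)) * qbin M p * (x ^ (u * (u + a)) * qbin p u * qbin (M - p) (a + u))))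
      = x ^ tri a * (x ^ (p * (p + a)) * qbin M p * qbin M (a + p))"
      by (simp only: sum_distrib_left)
  qed
  also have "\<dots> = x ^ tri a * qbin (2 * M) (M + a)"
    unfolding sum_distrib_left[symmetric] mult_2 qbin_Vandermonde' ..
  finally show ?thesis .
qed

lemma sum_level_inf:
  "(\<Sum>i\<le>M. x ^ tri (i - 1) * qbin M i * level_inf a b i) = x ^ (tri (b - 1) + tri (a + b)) * qbin (2 * M) (M + (a + b))"
proof -
  have "(\<Sum>i\<le>M. x ^ tri (i - 1) * qbin M i * level_inf a b i)
    = x ^ tri (b - 1) * (\<Sum>i\<le>M. x ^ tri (i - 1) * qbin M i * level_inf (a + b) 0 i)"
    unfolding level_inf_eq[of a b] sum_distrib_left by (simp add: mult_ac)
  then show ?thesis unfolding sum_level_inf_0 by (simp add: power_add)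
qed

end

section \<open>Bases q and q^3 together: the sum over m\<close>

locale q_cubic = q_generic q for q :: "'a::field"
begin

sublocale cube: q_generic "q ^ 3"
proof
  show "k > 0 \<Longrightarrow> (q ^ 3) ^ k \<noteq> 1" for k
    using not_root[of "3 * k"] by (simp add: power_mult)
qed simp

text \<open>This is q^j Q^(j^2/2) in the normalisation of \<open>trinom_term\<close>: since j^2 = 2
  tri(|j| - 1) + |j|, the remaining Q^(|j|/2) is the normalising factor Q^(a/2) at a = |j|.\<close>

definition weight :: "int \<Rightarrow> 'a" where
  "weight j = q powi j * (q ^ 3) ^ tri (nat \<bar>j\<bar> - 1)"

text \<open>The exponents k + 1 run through 2, ..., 3M + 1, that is through 3l - 1, 3l, 3l + 1 for l
  = 1, ..., M. The multiples of 3 form \<open>cube.qprod M\<close>, the very factor contained in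
  \<open>cube.trinomial\<close>. The start at 2 comes from the substitution z = q^(3/2) X, which
  absorbs the normalising power Q^(L/2).\<close>

lemma prod_thirds:
  "(\<Prod>k=1..3 * M. 1 + fps_const (q * q ^ k) * fps_X)
    = cube.qprod M * ((\<Prod>k=1..M. 1 + fps_const (q * (q ^ 3) ^ k) * fps_X)
        * (\<Prod>k=1..M. 1 + fps_const (inverse q * (q ^ 3) ^ k) * fps_X))"
proof (induction M)
  case (Suc M)
  define F where "F = (\<lambda>c. 1 + fps_const c * (fps_X :: 'a fps))"
  have e: "(q ^ 3) ^ Suc M = q ^ (3 * M) * q ^ 3"
    unfolding power_mult[symmetric] power_add[symmetric] by (rule arg_cong[where f = "power q"]) simp
  have 1: "q * q ^ Suc (3 * M) = inverse q * (q ^ 3) ^ Suc M"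
    unfolding e unfolding power_Suc power3_eq_cube by (simp add: field_simps)
  have 2: "q * q ^ Suc (Suc (3 * M)) = (q ^ 3) ^ Suc M"
    unfolding e unfolding power_Suc power3_eq_cube by (simp add: mult_ac)
  have 3: "q * q ^ Suc (Suc (Suc (3 * M))) = q * (q ^ 3) ^ Suc M"
    unfolding e unfolding power_Suc power3_eq_cube by (simp add: mult_ac)
  have step: "(\<Prod>k=1..Suc n. G k) = (\<Prod>k=1..n. G k) * G (Suc n)" for n and G :: "nat \<Rightarrow> 'a fps"
    by simp
  have IH: "(\<Prod>k=1..3 * M. F (q * q ^ k))
    = cube.qprod M * ((\<Prod>k=1..M. F (q * (q ^ 3) ^ k)) * (\<Prod>k=1..M. F (inverse q * (q ^ 3) ^ k)))"
    unfolding F_def by (rule Suc.IH)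
  have PS: "cube.qprod (Suc M) = cube.qprod M * F ((q ^ 3) ^ Suc M)"
    unfolding F_def by (rule cube.qprod_Suc)
  have M: "3 * Suc M = Suc (Suc (Suc (3 * M)))" by simp
  have "(\<Prod>k=1..3 * Suc M. F (q * q ^ k))
    = (\<Prod>k=1..3 * M. F (q * q ^ k)) * F (inverse q * (q ^ 3) ^ Suc M) * F ((q ^ 3) ^ Suc M) * F (q * (q ^ 3) ^ Suc M)"
    unfolding M step 1 2 3 ..
  also have "\<dots> = cube.qprod (Suc M) * ((\<Prod>k=1..Suc M. F (q * (q ^ 3) ^ k)) * (\<Prod>k=1..Suc M. F (inverse q * (q ^ 3) ^ k)))"
    unfolding IH PS step by (simp only: mult_ac)
  finally show ?case unfolding F_def .
qed simp

text \<open>Reversing k turns the sum into \<open>qbin_Saalschuetz\<close> in base q^3 with u = M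
  and v = M - j; for j > M both sides vanish.\<close>

lemma Saalschuetz_row_ge:
  assumes s: "s = r + j"
  shows "(\<Sum>k\<le>r. (q ^ 3) ^ (tri (s - k) + tri (r - k) + k) * cube.qbin M (s - k) * cube.qbin M (r - k) * cube.gauss (int k) (int (2 * M)))
     = (q ^ 3) ^ tri (j - 1) * cube.trinom_term (int j) (int j) (int M) (int (r + s))"
proof -
  have "(\<Sum>k\<le>r. (q ^ 3) ^ (tri (s - k) + tri (r - k) + k) * cube.qbin M (s - k) * cube.qbin M (r - k) * cube.gauss (int k) (int (2 * M)))
    = (\<Sum>k\<le>r. (q ^ 3) ^ (tri (j + k) + tri k + (r - k)) * cube.qbin M (j + k) * cube.qbin M k * cube.gauss (int (r - k)) (int (2 * M)))"
    by (rule sum.reindex_bij_witness[of _ "\<lambda>k. r - k" "\<lambda>k. r - k"]) (auto simp: s add.commute)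
  also have "\<dots> = (q ^ 3) ^ (tri (j - 1) + s) * (\<Sum>k\<le>r. (q ^ 3) ^ (k * (k + j)) * cube.qbin M k * cube.qbin M (j + k) * cube.gauss (int s - int j - int k) (int (2 * M)))"
    unfolding sum_distrib_left
  proof (rule sum.cong[OF refl])
    fix k assume k: "k \<in> {..r}"
    have "tri j = tri (j - 1) + j"
      by (cases j) (simp_all add: tri_Suc)
    then have "tri (j + k) + tri k + (r - k) = (tri (j - 1) + s) + k * (k + j)"
      using two_tri[of k] k by (simp add: tri_add s algebra_simps)
    moreover have "int (r - k) = int s - int j - int k" using k by (simp add: s)
    ultimately show "(q ^ 3) ^ (tri (j + k) + tri k + (r - k)) * cube.qbin M (j + k) * cube.qbin M k * cube.gauss (int (r - k)) (int (2 * M))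
      = (q ^ 3) ^ (tri (j - 1) + s) * ((q ^ 3) ^ (k * (k + j)) * cube.qbin M k * cube.qbin M (j + k) * cube.gauss (int s - int j - int k) (int (2 * M)))"
      by (simp only: power_add mult_ac)
  qed
  also have "(\<Sum>k\<le>r. (q ^ 3) ^ (k * (k + j)) * cube.qbin M k * cube.qbin M (j + k) * cube.gauss (int s - int j - int k) (int (2 * M)))
     = cube.gauss (int M + int j) (int r) * cube.gauss (int M - int j) (int s)"
  proof (cases "j \<le> M")
    case False
    then show ?thesis by (simp add: cube.gauss_neg cube.qbin_zero)
  next
    case True
    then obtain v where M: "M = v + j" by (metis le_add_diff_inverse2)
    have "cube.gauss (int M + int j) (int r) * cube.gauss (int M - int j) (int s)
      = cube.gauss (int s - int j) (int (M + j)) * cube.qbin (s + v) v"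
      unfolding cube.qbin_eq_gauss
      by (subst cube.gauss_commute, subst cube.gauss_commute[of "int M - int j"]) (simp add: M s)
    also have "\<dots> = (\<Sum>k\<le>v. (q ^ 3) ^ (k * (k + j)) * cube.qbin M k * cube.qbin (v + j) (j + k)
                * cube.gauss (int s - int j - int k) (int (M + v + j)))"
      by (rule cube.qbin_Saalschuetz)
    also have "\<dots> = (\<Sum>k\<le>r. (q ^ 3) ^ (k * (k + j)) * cube.qbin M k * cube.qbin M (j + k) * cube.gauss (int s - int j - int k) (int (2 * M)))"
      by (rule sum.mono_neutral_cong) (auto simp: cube.qbin_zero cube.gauss_neg M s add.commute)
    finally show ?thesis by simp
  qed
  also have "(q ^ 3) ^ (tri (j - 1) + s) * \<dots> = (q ^ 3) ^ tri (j - 1) * cube.trinom_term (int j) (int j) (int M) (int (r + s))"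
  proof -
    have e: "int (r + s) = int j + 2 * int r" "int r + int j = int s" by (simp_all add: s)
    show ?thesis unfolding cube.trinom_term_even[OF e(1)] e(2) power_int_of_nat by (simp add: power_add mult_ac)
  qed
  finally show ?thesis .
qed

lemma Saalschuetz_row:
  "(\<Sum>k\<le>min r s. (q ^ 3) ^ (tri (s - k) + tri (r - k) + k) * cube.qbin M (s - k) * cube.qbin M (r - k) * cube.gauss (int k) (int (2 * M)))
     = (q ^ 3) ^ tri (nat \<bar>int s - int r\<bar> - 1) * cube.trinom_term \<bar>int s - int r\<bar> \<bar>int s - int r\<bar> (int M) (int (r + s))"
proof (cases "r \<le> s")
  case True
  then obtain j where s: "s = r + j" by (auto simp: le_iff_add)
  then show ?thesis using Saalschuetz_row_ge[OF s, of M] by simp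
next
  case False
  then obtain j where r: "r = s + j" by (metis le_iff_add nat_le_linear)
  then show ?thesis using Saalschuetz_row_ge[OF r, of M] by (simp add: mult_ac add_ac)
qed

text \<open>The sum over m for M = n_nu and L = i - (N_1 + ... + N_nu). The part 3L/2 of the
  exponent is the normalising power Q^(L/2); it makes the exponent an integer, since m^2 + 3L has
  the parity of L + m.\<close>

definition seed :: "nat \<Rightarrow> nat \<Rightarrow> 'a" where
  "seed L M = (\<Sum>m\<le>3 * M. if even (L + m) \<and> m \<le> L
     then q ^ ((m ^ 2 + 3 * L) div 2) * qbin (3 * M) m * cube.gauss (int ((L - m) div 2)) (int (2 * M)) else 0)"

text \<open>The series 1 / (Q X^2; Q)_(2M+1), which is 1 / (z^2; Q)_(2M+1) at z = q^(3/2) X.\<close>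

definition geom :: "nat \<Rightarrow> 'a fps" where
  "geom M = Abs_fps (\<lambda>k. if even k then (q ^ 3) ^ (k div 2) * cube.gauss (int (k div 2)) (int (2 * M)) else 0)"

lemma seed_eq_nth: "seed L M = fps_nth ((\<Prod>k=1..3 * M. 1 + fps_const (q * q ^ k) * fps_X) * geom M) L"
proof -
  have "fps_nth ((\<Prod>k=1..3 * M. 1 + fps_const (q * q ^ k) * fps_X) * geom M) L
    = (\<Sum>m\<le>L. q ^ m * q ^ tri m * qbin (3 * M) m * fps_nth (geom M) (L - m))"
    unfolding fps_mult_nth prod_linear_nth atLeast0AtMost ..
  also have "\<dots> = seed L M"
    unfolding seed_def
  proof (rule sum.mono_neutral_cong)
    fix m assume "m \<in> {..L} \<inter> {..3 * M}"
    then have m: "m \<le> L" by simp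
    show "q ^ m * q ^ tri m * qbin (3 * M) m * fps_nth (geom M) (L - m)
      = (if even (L + m) \<and> m \<le> L then q ^ ((m ^ 2 + 3 * L) div 2) * qbin (3 * M) m * cube.gauss (int ((L - m) div 2)) (int (2 * M)) else 0)"
    proof (cases "even (L + m)")
      case True
      then have "even (L - m)" using m by simp
      then obtain u where "L - m = 2 * u" by (elim evenE)
      then have L: "L = m + 2 * u" using m by simp
      have "m ^ 2 + 3 * L = 2 * (m + tri m + 3 * u)"
        using two_tri[of m] by (simp add: L power2_eq_square)
      then have "(m ^ 2 + 3 * L) div 2 = m + tri m + 3 * u" by simp
      then show ?thesis by (simp add: L geom_def power_add power_mult)
    qed (use m in \<open>simp add: geom_def\<close>)
  qed (auto simp: qbin_zero)
  finally show ?thesis ..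
qed

text \<open>Degrees sigma and rho from the two products and 2u from \<open>geom\<close> are grouped
  by s = sigma + u and r = rho + u. With s and r fixed, \<open>Saalschuetz_row\<close> sums over u,
  and the scalars q and 1/q leave q^j for j = s - r. Terms with |j| > M vanish, so any J >= M will
  do; a single J can then serve all N <= M in \<open>nested_eq\<close>.\<close>

lemma theta_geom:
  assumes "J \<ge> M"
  shows "(\<Prod>k=1..M. 1 + fps_const (q * (q ^ 3) ^ k) * fps_X)
        * (\<Prod>k=1..M. 1 + fps_const (inverse q * (q ^ 3) ^ k) * fps_X) * geom M
    = (\<Sum>j=-int J..int J. fps_const (weight j) * cube.trinom_series (nat \<bar>j\<bar>) (nat \<bar>j\<bar>) M)"
    (is "?B * ?A * _ = _")
proof (rule fps_ext)
  fix k
  define h where "h = (\<lambda>\<sigma> \<rho> u. fps_nth ?B \<sigma> * fps_nth ?A \<rho> * ((q ^ 3) ^ u * cube.gauss (int u) (int (2 * M))))"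
  define g where "g = (\<lambda>j. weight j * cube.trinom_term \<bar>j\<bar> \<bar>j\<bar> (int M) (int k))"
  have hsum: "(\<Sum>u\<le>min (k - s) s. h (s - u) (k - s - u) u) = g (2 * int s - int k)" if "s \<le> k" for s
  proof -
    define r where "r = k - s"
    have k: "k = r + s" using that by (simp add: r_def)
    have hq: "h (s - u) (r - u) u = q powi (int s - int r) *
       ((q ^ 3) ^ (tri (s - u) + tri (r - u) + u) * cube.qbin M (s - u) * cube.qbin M (r - u) * cube.gauss (int u) (int (2 * M)))"
      if "u \<le> min r s" for u
    proof -
      have "q powi (int s - int r) = q powi (int (s - u) - int (r - u))" using that by simp
      also have "\<dots> = q ^ (s - u) * inverse q ^ (r - u)"
        by (simp add: powi_diff power_inverse divide_inverse)
      finally show ?thesis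
        unfolding h_def cube.prod_linear_nth by (simp add: power_add mult_ac)
    qed
    have "(\<Sum>u\<le>min r s. h (s - u) (r - u) u) = q powi (int s - int r) *
       ((q ^ 3) ^ tri (nat \<bar>int s - int r\<bar> - 1) * cube.trinom_term \<bar>int s - int r\<bar> \<bar>int s - int r\<bar> (int M) (int (r + s)))"
      unfolding Saalschuetz_row[symmetric] sum_distrib_left by (rule sum.cong) (simp_all add: hq)
    also have "\<dots> = g (2 * int s - int k)"
      by (simp add: g_def weight_def k)
    finally show ?thesis unfolding r_def .
  qed
  have "fps_nth (?B * ?A * geom M) k = (\<Sum>i\<le>k. fps_nth (?B * ?A) i * fps_nth (geom M) (k - i))"
    unfolding fps_mult_nth[of "?B * ?A"] atLeast0AtMost ..
  also have "\<dots> = (\<Sum>i\<in>{i. i \<le> k \<and> even (k - i)}. fps_nth (?B * ?A) i * fps_nth (geom M) (k - i))"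
    by (rule sum.mono_neutral_right) (auto simp: geom_def)
  also have "\<dots> = (\<Sum>u\<in>{u. 2 * u \<le> k}. fps_nth (?B * ?A) (k - 2 * u) * ((q ^ 3) ^ u * cube.gauss (int u) (int (2 * M))))"
    by (rule sum.reindex_bij_witness[of _ "\<lambda>u. k - 2 * u" "\<lambda>i. (k - i) div 2"]) (auto simp: geom_def)
  also have "\<dots> = (\<Sum>u\<in>{u. 2 * u \<le> k}. \<Sum>\<sigma>\<le>k - 2 * u. h \<sigma> (k - 2 * u - \<sigma>) u)"
    unfolding fps_mult_nth atLeast0AtMost sum_distrib_right h_def by simp
  also have "\<dots> = (\<Sum>(u, \<sigma>)\<in>(SIGMA u:{u. 2 * u \<le> k}. {..k - 2 * u}). h \<sigma> (k - 2 * u - \<sigma>) u)"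
    by (rule sum.Sigma) (auto intro: finite_subset[of _ "{..k}"])
  also have "\<dots> = (\<Sum>(s, u)\<in>(SIGMA s:{..k}. {..min (k - s) s}). h (s - u) (k - s - u) u)"
    by (rule sum.reindex_bij_witness[of _ "\<lambda>(s, u). (u, s - u)" "\<lambda>(u, \<sigma>). (u + \<sigma>, u)"]) (auto simp: mult_2 add_ac)
  also have "\<dots> = (\<Sum>s\<le>k. \<Sum>u\<le>min (k - s) s. h (s - u) (k - s - u) u)"
    by (rule sum.Sigma[symmetric]) auto
  also have "\<dots> = (\<Sum>s\<le>k. g (2 * int s - int k))"
    by (rule sum.cong[OF refl]) (rule hsum, simp)
  also have "\<dots> = sum g ((\<lambda>s. 2 * int s - int k) ` {..k})"
    by (simp add: sum.reindex inj_on_def)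
  also have "\<dots> = (\<Sum>j=-int J..int J. g j)"
  proof (rule sum.mono_neutral_cong)
    fix j assume j: "j \<in> {-int J..int J} - (\<lambda>s. 2 * int s - int k) ` {..k}"
    show "g j = 0"
    proof (cases "\<bar>j\<bar> > int k \<or> odd (int k - \<bar>j\<bar>)")
      case True
      then show ?thesis by (auto simp: g_def cube.trinom_term_less cube.trinom_term_odd)
    next
      case False
      then have "even (int k + j)" "\<bar>j\<bar> \<le> int k" by auto
      then obtain s where "int k + j = 2 * s" by (elim evenE)
      with \<open>\<bar>j\<bar> \<le> int k\<close> have "j = 2 * int (nat s) - int k" "nat s \<le> k" by auto
      with j show ?thesis by blast
    qed
  next
    fix j assume "j \<in> (\<lambda>s. 2 * int s - int k) ` {..k} - {-int J..int J}"
    then have "\<bar>j\<bar> > int M" using assms by auto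
    then show "g j = 0" by (simp add: g_def cube.trinom_term_def cube.gauss_neg)
  qed auto
  also have "\<dots> = fps_nth (\<Sum>j=-int J..int J. fps_const (weight j) * cube.trinom_series (nat \<bar>j\<bar>) (nat \<bar>j\<bar>) M) k"
    by (simp add: fps_sum_nth g_def cube.trinom_series_nth)
  finally show "fps_nth (?B * ?A * geom M) k = fps_nth (\<Sum>j=-int J..int J. fps_const (weight j) * cube.trinom_series (nat \<bar>j\<bar>) (nat \<bar>j\<bar>) M) k" .
qed

lemma seed_eq:
  assumes "J \<ge> M"
  shows "seed L M = (\<Sum>j=-int J..int J. weight j * fps_nth (cube.trinomial (nat \<bar>j\<bar>) (nat \<bar>j\<bar>) M) L)"
proof -
  have "seed L M = fps_nth (cube.qprod M * (\<Sum>j=-int J..int J. fps_const (weight j) * cube.trinom_series (nat \<bar>j\<bar>) (nat \<bar>j\<bar>) M)) L"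
    unfolding seed_eq_nth prod_thirds theta_geom[OF assms, symmetric] by (simp add: mult_ac)
  also have "\<dots> = fps_nth (\<Sum>j=-int J..int J. fps_const (weight j) * cube.trinomial (nat \<bar>j\<bar>) (nat \<bar>j\<bar>) M) L"
    unfolding cube.trinomial_def sum_distrib_left by (simp only: mult.left_commute)
  finally show ?thesis by (simp add: fps_sum_nth)
qed

section \<open>Iteration over N_2, ..., N_nu\<close>

fun nested :: "nat \<Rightarrow> int \<Rightarrow> nat \<Rightarrow> 'a" where
  "nested 0 L M = (if L < 0 then 0 else seed (nat L) M)"
| "nested (Suc k) L M = (\<Sum>N\<le>M. (q ^ 3) ^ tri N * cube.gauss (int M - int N) L * nested k (L - int N) N)"

lemma nested_neg: "L < 0 \<Longrightarrow> nested k L M = 0"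
  by (cases k) (simp_all add: cube.gauss_neg)

text \<open>In \<open>nested\<close>, k counts the remaining sums, M is the current tail sum
  N_(nu-k), and L is what is left of i, an integer since it may become negative. Each further sum is
  one use of \<open>level_eq\<close> with b = |j|: it adds |j| to a and contributes
  \<open>(q ^ 3) ^ tri (|j| - 1)\<close>.\<close>

lemma nested_eq:
  assumes "M \<le> J"
  shows "nested k (int L) M = (\<Sum>j=-int J..int J. weight j * (q ^ 3) ^ (k * tri (nat \<bar>j\<bar> - 1))
     * fps_nth (cube.trinomial (Suc k * nat \<bar>j\<bar>) (nat \<bar>j\<bar>) M) L)"
  using assms
proof (induction k arbitrary: L M)
  case 0
  then show ?case by (simp add: seed_eq)
next
  case (Suc k)
  define c where "c = (\<lambda>j. weight j * (q ^ 3) ^ (k * tri (nat \<bar>j\<bar> - 1)))"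
  have "nested k (int L - int N) N = (\<Sum>j=-int J..int J. c j * cube.trinom_coeff (Suc k * nat \<bar>j\<bar>) (nat \<bar>j\<bar>) N L)"
    if "N \<le> M" for N
  proof (cases "N \<le> L")
    case True
    then have "int L - int N = int (L - N)" by simp
    then show ?thesis
      using Suc.IH[of N "L - N"] Suc.prems that True
      by (simp add: c_def cube.trinom_coeff_def fps_X_power_mult_nth)
  next
    case False
    then show ?thesis by (simp add: nested_neg cube.trinom_coeff_less)
  qed
  then have "nested (Suc k) (int L) M = (\<Sum>N\<le>M. \<Sum>j=-int J..int J. c j *
      ((q ^ 3) ^ tri N * cube.gauss (int M - int N) (int L) * cube.trinom_coeff (Suc k * nat \<bar>j\<bar>) (nat \<bar>j\<bar>) N L))"
    unfolding nested.simps by (intro sum.cong refl) (simp add: sum_distrib_left mult_ac)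
  also have "\<dots> = (\<Sum>j=-int J..int J. c j * cube.level (Suc k * nat \<bar>j\<bar>) (nat \<bar>j\<bar>) L M)"
    unfolding cube.level_def sum_distrib_left by (rule sum.swap)
  also have "\<dots> = (\<Sum>j=-int J..int J. weight j * (q ^ 3) ^ (Suc k * tri (nat \<bar>j\<bar> - 1))
     * fps_nth (cube.trinomial (Suc (Suc k) * nat \<bar>j\<bar>) (nat \<bar>j\<bar>) M) L)"
    unfolding cube.level_eq c_def by (intro sum.cong refl) (simp add: power_add mult_ac add_ac)
  finally show ?case .
qed

text \<open>
  The exponent \<open>i * (i - 1) / 2\<close> in place of \<open>i\<^sup>2 / 2\<close> undoes the factor \<open>x\<close> to the power \<open>i / 2\<close>
  carried by \<open>nested\<close>.
\<close>

lemma outer_sum: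
  "(\<Sum>i\<le>M. (q ^ 3) ^ tri (i - 1) * cube.qbin M i * (\<Sum>N\<le>i. (q ^ 3) ^ tri N * nested k (int i - int N) N))
    = (\<Sum>j=-int M..int M. q powi (3 * int ((k + 3) choose 2) * j ^ 2 + j)
         * q_binomial (q ^ 3) (2 * int M) (int M + int (k + 2) * j))"
proof -
  define c where "c = (\<lambda>j. weight j * (q ^ 3) ^ (k * tri (nat \<bar>j\<bar> - 1)))"
  have Vk: "nested k (int i - int N) N = (\<Sum>j=-int M..int M. c j * cube.trinom_coeff (Suc k * nat \<bar>j\<bar>) (nat \<bar>j\<bar>) N i)"
    if "N \<le> i" "i \<le> M" for N i
  proof -
    have "int i - int N = int (i - N)" using that by simp
    then show ?thesis
      using nested_eq[of N M k "i - N"] that by (simp add: c_def cube.trinom_coeff_def fps_X_power_mult_nth)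
  qed
  have "(\<Sum>i\<le>M. (q ^ 3) ^ tri (i - 1) * cube.qbin M i * (\<Sum>N\<le>i. (q ^ 3) ^ tri N * nested k (int i - int N) N))
    = (\<Sum>i\<le>M. (q ^ 3) ^ tri (i - 1) * cube.qbin M i * (\<Sum>N\<le>i. \<Sum>j=-int M..int M. c j * ((q ^ 3) ^ tri N * cube.trinom_coeff (Suc k * nat \<bar>j\<bar>) (nat \<bar>j\<bar>) N i)))"
    by (intro sum.cong refl arg_cong2[where f = "(*)"]) (simp add: Vk sum_distrib_left mult_ac)
  also have "\<dots> = (\<Sum>i\<le>M. (q ^ 3) ^ tri (i - 1) * cube.qbin M i * (\<Sum>j=-int M..int M. c j * cube.level_inf (Suc k * nat \<bar>j\<bar>) (nat \<bar>j\<bar>) i))"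
    unfolding cube.level_inf_def sum_distrib_left[of "c _"]
    by (intro sum.cong refl arg_cong2[where f = "(*)"]) (rule sum.swap)
  also have "\<dots> = (\<Sum>i\<le>M. \<Sum>j=-int M..int M. c j * ((q ^ 3) ^ tri (i - 1) * cube.qbin M i * cube.level_inf (Suc k * nat \<bar>j\<bar>) (nat \<bar>j\<bar>) i))"
    unfolding sum_distrib_left by (simp only: mult_ac)
  also have "\<dots> = (\<Sum>j=-int M..int M. \<Sum>i\<le>M. c j * ((q ^ 3) ^ tri (i - 1) * cube.qbin M i * cube.level_inf (Suc k * nat \<bar>j\<bar>) (nat \<bar>j\<bar>) i))"
    by (rule sum.swap)
  also have "\<dots> = (\<Sum>j=-int M..int M. q powi (3 * int ((k + 3) choose 2) * j ^ 2 + j)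
         * q_binomial (q ^ 3) (2 * int M) (int M + int (k + 2) * j))"
  proof (rule sum.cong[OF refl])
    fix j
    define b where "b = nat \<bar>j\<bar>"
    have jb: "j ^ 2 = int (b ^ 2)" by (simp add: b_def)
    have tb: "2 * tri (b - 1) + b = b ^ 2"
      by (cases b) (simp_all add: two_tri power2_eq_square)
    have ch: "2 * ((k + 3) choose 2) = (k + 3) * (k + 2)"
      by (simp add: choose_two)
    \<comment> \<open>The k + 2 copies of \<open>tri (b - 1)\<close> come one from
      \<open>weight\<close>, k from \<open>nested_eq\<close> and one from
      \<open>sum_level_inf\<close>. Against \<open>tri\<close> of the final a = (k + 2) b the terms
      linear in b cancel.\<close>
    have "2 * ((k + 2) * tri (b - 1) + tri (Suc k * b + b)) = (k + 2) * (2 * tri (b - 1) + b) + (k + 2) ^ 2 * b ^ 2"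
      using two_tri[of "Suc k * b + b"] by (simp add: power2_eq_square algebra_simps)
    also have "\<dots> = 2 * ((k + 3) choose 2) * b ^ 2"
      unfolding tb ch by (simp add: power2_eq_square algebra_simps)
    finally have e: "(k + 2) * tri (b - 1) + tri (Suc k * b + b) = ((k + 3) choose 2) * b ^ 2"
      by simp
    have "c j * (q ^ 3) ^ (tri (b - 1) + tri (Suc k * b + b))
      = q powi j * (q ^ 3) ^ ((k + 2) * tri (b - 1) + tri (Suc k * b + b))"
      unfolding c_def weight_def b_def by (simp add: power_add mult_ac)
    also have "\<dots> = q powi (3 * int ((k + 3) choose 2) * j ^ 2 + j)"
    proof -
      have "3 * int ((k + 3) choose 2) * j ^ 2 = int (3 * (((k + 3) choose 2) * b ^ 2))"
        unfolding jb by simp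
      then have "q powi (3 * int ((k + 3) choose 2) * j ^ 2 + j) = q ^ (3 * (((k + 3) choose 2) * b ^ 2)) * q powi j"
        by (simp only: powi_add power_int_of_nat)
      then show ?thesis unfolding e by (simp add: power_mult mult.commute)
    qed
    finally have 1: "c j * (q ^ 3) ^ (tri (b - 1) + tri (Suc k * b + b)) = q powi (3 * int ((k + 3) choose 2) * j ^ 2 + j)" .
    \<comment> \<open>The left side depends on |j| only; negative j is reached by the symmetry of
      the binomial about M.\<close>
    have 2: "cube.qbin (2 * M) (M + (Suc k * b + b)) = q_binomial (q ^ 3) (2 * int M) (int M + int (k + 2) * j)"
    proof (cases "j \<ge> 0")
      case True
      then have "int (M + (Suc k * b + b)) = int M + int (k + 2) * j"
        by (simp add: b_def algebra_simps)
      then show ?thesis by (simp add: cube.qbin_def)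
    next
      case False
      then have "int (M + (Suc k * b + b)) = 2 * int M - (int M + int (k + 2) * j)"
        by (simp add: b_def algebra_simps)
      then show ?thesis
        unfolding cube.qbin_def cube.q_binomial_eq_gauss by (subst cube.gauss_commute) simp
    qed
    show "(\<Sum>i\<le>M. c j * ((q ^ 3) ^ tri (i - 1) * cube.qbin M i * cube.level_inf (Suc k * nat \<bar>j\<bar>) (nat \<bar>j\<bar>) i))
      = q powi (3 * int ((k + 3) choose 2) * j ^ 2 + j)
         * q_binomial (q ^ 3) (2 * int M) (int M + int (k + 2) * j)"
      unfolding sum_distrib_left[symmetric] cube.sum_level_inf b_def[symmetric] 2
      unfolding mult.assoc[symmetric] 1 ..
  qed
  finally show ?thesis .
qed

end

section \<open>From tuples of parts to successive tail sums\<close>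

definition parts :: "nat \<Rightarrow> nat \<Rightarrow> nat \<Rightarrow> (nat \<Rightarrow> nat) set" where
  "parts \<nu> k N = {n \<in> {k..\<nu>} \<rightarrow>\<^sub>E UNIV. sum n {k..\<nu>} = N}"

lemma finite_parts: "finite (parts \<nu> k N)"
proof (rule finite_subset)
  show "parts \<nu> k N \<subseteq> {k..\<nu>} \<rightarrow>\<^sub>E {..N}"
  proof
    fix n assume n: "n \<in> parts \<nu> k N"
    have "n i \<le> N" if "i \<in> {k..\<nu>}" for i
      using n that member_le_sum[of i "{k..\<nu>}" n] by (simp add: parts_def)
    with n show "n \<in> {k..\<nu>} \<rightarrow>\<^sub>E {..N}"
      unfolding parts_def by (auto simp: PiE_iff)
  qed
  show "finite ({k..\<nu>} \<rightarrow>\<^sub>E {..N})" by (intro finite_PiE) auto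
qed

lemma parts_last: "parts \<nu> \<nu> N = {(\<lambda>i. if i = \<nu> then N else undefined)}"
  by (auto simp: parts_def PiE_iff extensional_def fun_eq_iff)

text \<open>With N' the sum of the later parts, n_k = N - N'; repeated use replaces the tuple by its
  tail sums, the variables of \<open>nested\<close>. Resetting the entry at k to
  \<open>undefined\<close> keeps the functions extensional and makes this a bijection.\<close>

lemma sum_parts_Suc:
  fixes f :: "(nat \<Rightarrow> nat) \<Rightarrow> 'a::comm_monoid_add"
  assumes "k < \<nu>"
  shows "(\<Sum>n\<in>parts \<nu> k N. f n) = (\<Sum>N'\<le>N. \<Sum>n\<in>parts \<nu> (Suc k) N'. f (n(k := N - N')))"
proof -
  have ins: "{k..\<nu>} = insert k {Suc k..\<nu>}" using assms by auto
  have "(\<Sum>N'\<le>N. \<Sum>n\<in>parts \<nu> (Suc k) N'. f (n(k := N - N')))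
    = (\<Sum>(N', n)\<in>(SIGMA N':{..N}. parts \<nu> (Suc k) N'). f (n(k := N - N')))"
    by (rule sum.Sigma) (auto simp: finite_parts)
  also have "\<dots> = (\<Sum>n\<in>parts \<nu> k N. f n)"
  proof (rule sum.reindex_bij_witness[of _ "\<lambda>n. (N - n k, n(k := undefined))" "\<lambda>(N', n). n(k := N - N')"], goal_cases)
    case (1 z)
    then obtain N' n where z: "z = (N', n)" "N' \<le> N" "n \<in> parts \<nu> (Suc k) N'" by auto
    then have "n k = undefined" by (auto simp: parts_def PiE_iff extensional_def)
    then show ?case using z by (auto simp: fun_eq_iff)
  next
    case (2 z)
    then obtain N' n where z: "z = (N', n)" "N' \<le> N" "n \<in> parts \<nu> (Suc k) N'" by auto
    have "sum (n(k := N - N')) {Suc k..\<nu>} = sum n {Suc k..\<nu>}" by (rule sum.cong) auto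
    then have "sum (n(k := N - N')) {k..\<nu>} = N"
      unfolding ins using z by (simp add: parts_def)
    then show ?case using z assms by (auto simp: parts_def PiE_iff extensional_def)
  next
    case (3 n)
    then have "n k + sum n {Suc k..\<nu>} = N" unfolding parts_def ins by auto
    then show ?case by (auto simp: fun_eq_iff)
  next
    case (4 n)
    then have n: "n \<in> {k..\<nu>} \<rightarrow>\<^sub>E UNIV" "n k + sum n {Suc k..\<nu>} = N"
      unfolding parts_def ins by auto
    have "sum (n(k := undefined)) {Suc k..\<nu>} = sum n {Suc k..\<nu>}" by (rule sum.cong) auto
    then show ?case using n by (auto simp: parts_def PiE_iff extensional_def)
  next
    case (5 z)
    then show ?case by auto
  qed
  finally show ?thesis ..
qed

lemma tail_sum_upd: "k < l \<Longrightarrow> tail_sum \<nu> (n(k := v)) l = tail_sum \<nu> n l"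
  unfolding tail_sum_def by (rule sum.cong) auto

context q_cubic
begin

text \<open>Downward induction on k with N = N_k. Since n_k = N_k - N_(k+1), the binomial at j = k
  is the factor \<open>cube.gauss (N - N') L\<close> of \<open>nested\<close>, and what remains is
  the sum for k + 1 with L lowered by N_(k+1).\<close>

lemma sum_parts_nested:
  assumes "k \<le> \<nu>"
  shows "(\<Sum>n\<in>parts \<nu> k N. (\<Prod>l=Suc k..\<nu>. (q ^ 3) ^ tri (tail_sum \<nu> n l))
      * (\<Prod>j=k..<\<nu>. q_binomial (q ^ 3) (L - (\<Sum>l=Suc k..j. int (tail_sum \<nu> n l)) + int (n j)) (int (n j)))
      * nested 0 (L - (\<Sum>l=Suc k..\<nu>. int (tail_sum \<nu> n l))) (n \<nu>))
    = nested (\<nu> - k) L N"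
  using assms
proof (induction k arbitrary: L N rule: inc_induct)
  case base
  show ?case by (simp add: parts_last)
next
  case (step k)
  let ?T = "\<lambda>n l. int (tail_sum \<nu> n l)"
  define f where "f = (\<lambda>k L n. (\<Prod>l=Suc k..\<nu>. (q ^ 3) ^ tri (tail_sum \<nu> n l))
      * (\<Prod>j=k..<\<nu>. q_binomial (q ^ 3) (L - (\<Sum>l=Suc k..j. ?T n l) + int (n j)) (int (n j)))
      * nested 0 (L - (\<Sum>l=Suc k..\<nu>. ?T n l)) (n \<nu>))"
  have IH: "(\<Sum>n\<in>parts \<nu> (Suc k) N. f (Suc k) L n) = nested (\<nu> - Suc k) L N" for L N
    unfolding f_def by (rule step.IH)
  have f: "f k L (n(k := N - N')) = (q ^ 3) ^ tri N' * cube.gauss (int N - int N') L * f (Suc k) (L - int N') n"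
    if "n \<in> parts \<nu> (Suc k) N'" "N' \<le> N" for n N'
  proof -
    define n' where "n' = n(k := N - N')"
    have T: "tail_sum \<nu> n' l = tail_sum \<nu> n l" if "k < l" for l
      unfolding n'_def using that by (rule tail_sum_upd)
    have N': "tail_sum \<nu> n (Suc k) = N'"
      using that(1) by (simp add: tail_sum_def parts_def)
    have S: "(\<Sum>l=Suc k..j. ?T n' l) = int N' + (\<Sum>l=Suc (Suc k)..j. ?T n l)" if "k < j" for j
    proof -
      have "{Suc k..j} = insert (Suc k) {Suc (Suc k)..j}" using that by auto
      then have "(\<Sum>l=Suc k..j. ?T n' l) = ?T n' (Suc k) + (\<Sum>l=Suc (Suc k)..j. ?T n' l)" by simp
      also have "(\<Sum>l=Suc (Suc k)..j. ?T n' l) = (\<Sum>l=Suc (Suc k)..j. ?T n l)"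
        by (rule sum.cong) (auto simp: T)
      finally show ?thesis by (simp add: T N')
    qed
    have "{Suc k..\<nu>} = insert (Suc k) {Suc (Suc k)..\<nu>}" using step.hyps by auto
    then have "(\<Prod>l=Suc k..\<nu>. (q ^ 3) ^ tri (tail_sum \<nu> n' l))
       = (q ^ 3) ^ tri (tail_sum \<nu> n' (Suc k)) * (\<Prod>l=Suc (Suc k)..\<nu>. (q ^ 3) ^ tri (tail_sum \<nu> n' l))"
      by simp
    also have "(\<Prod>l=Suc (Suc k)..\<nu>. (q ^ 3) ^ tri (tail_sum \<nu> n' l)) = (\<Prod>l=Suc (Suc k)..\<nu>. (q ^ 3) ^ tri (tail_sum \<nu> n l))"
      by (rule prod.cong) (auto simp: T)
    finally have 1: "(\<Prod>l=Suc k..\<nu>. (q ^ 3) ^ tri (tail_sum \<nu> n' l)) = (q ^ 3) ^ tri N' * (\<Prod>l=Suc (Suc k)..\<nu>. (q ^ 3) ^ tri (tail_sum \<nu> n l))"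
      by (simp add: T N')
    have "{k..<\<nu>} = insert k {Suc k..<\<nu>}" using step.hyps by auto
    then have "(\<Prod>j=k..<\<nu>. q_binomial (q ^ 3) (L - (\<Sum>l=Suc k..j. ?T n' l) + int (n' j)) (int (n' j)))
      = q_binomial (q ^ 3) (L + int (n' k)) (int (n' k)) * (\<Prod>j=Suc k..<\<nu>. q_binomial (q ^ 3) (L - (\<Sum>l=Suc k..j. ?T n' l) + int (n' j)) (int (n' j)))"
      by simp
    also have "(\<Prod>j=Suc k..<\<nu>. q_binomial (q ^ 3) (L - (\<Sum>l=Suc k..j. ?T n' l) + int (n' j)) (int (n' j)))
      = (\<Prod>j=Suc k..<\<nu>. q_binomial (q ^ 3) (L - int N' - (\<Sum>l=Suc (Suc k)..j. ?T n l) + int (n j)) (int (n j)))"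
    proof (rule prod.cong[OF refl])
      fix j assume "j \<in> {Suc k..<\<nu>}"
      then have j: "k < j" "n' j = n j" by (auto simp: n'_def)
      show "q_binomial (q ^ 3) (L - (\<Sum>l=Suc k..j. ?T n' l) + int (n' j)) (int (n' j))
        = q_binomial (q ^ 3) (L - int N' - (\<Sum>l=Suc (Suc k)..j. ?T n l) + int (n j)) (int (n j))"
        unfolding S[OF j(1)] j(2) by (simp only: diff_diff_add)
    qed
    also have "q_binomial (q ^ 3) (L + int (n' k)) (int (n' k)) = cube.gauss (int N - int N') L"
      unfolding cube.q_binomial_eq_gauss by (subst cube.gauss_commute) (simp add: n'_def that(2))
    finally have 2: "(\<Prod>j=k..<\<nu>. q_binomial (q ^ 3) (L - (\<Sum>l=Suc k..j. ?T n' l) + int (n' j)) (int (n' j)))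
      = cube.gauss (int N - int N') L * (\<Prod>j=Suc k..<\<nu>. q_binomial (q ^ 3) (L - int N' - (\<Sum>l=Suc (Suc k)..j. ?T n l) + int (n j)) (int (n j)))" .
    have 3: "nested 0 (L - (\<Sum>l=Suc k..\<nu>. ?T n' l)) (n' \<nu>) = nested 0 (L - int N' - (\<Sum>l=Suc (Suc k)..\<nu>. ?T n l)) (n \<nu>)"
      unfolding S[OF step.hyps(2)] using step.hyps(2) by (simp only: diff_diff_add) (simp add: n'_def)
    show ?thesis
      unfolding f_def n'_def[symmetric] 1 2 3 by (simp only: mult_ac)
  qed
  have "\<nu> - k = Suc (\<nu> - Suc k)" using step.hyps by simp
  then have "nested (\<nu> - k) L N = (\<Sum>N'\<le>N. (q ^ 3) ^ tri N' * cube.gauss (int N - int N') L * (\<Sum>n\<in>parts \<nu> (Suc k) N'. f (Suc k) (L - int N') n))"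
    unfolding IH by simp
  also have "\<dots> = (\<Sum>N'\<le>N. \<Sum>n\<in>parts \<nu> (Suc k) N'. f k L (n(k := N - N')))"
    unfolding sum_distrib_left by (intro sum.cong refl) (simp add: f)
  also have "\<dots> = (\<Sum>n\<in>parts \<nu> k N. f k L n)"
    by (rule sum_parts_Suc[symmetric]) (rule step.hyps)
  finally show ?case unfolding f_def ..
qed


section \<open>Assembly of the multiple sum\<close>

definition summand :: "nat \<Rightarrow> nat \<Rightarrow> nat \<Rightarrow> nat \<Rightarrow> (nat \<Rightarrow> nat) \<Rightarrow> 'a" where
  "summand \<nu> M i m n = (if n \<in> {1..\<nu>} \<rightarrow>\<^sub>E UNIV \<and> [i + m = (\<Sum>k=1..\<nu>. tail_sum \<nu> n k)] (mod 2)
        then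
          q ^ ((m ^ 2 + 3 * (i ^ 2 + (\<Sum>k=1..\<nu>. (tail_sum \<nu> n k) ^ 2))) div 2)
          * q_binomial (q ^ 3) (int M) (int i)
          * q_binomial q (3 * int (n \<nu>)) (int m)
          * q_binomial (q ^ 3)
              (2 * int (n \<nu>) + (int i - (\<Sum>k=1..\<nu>. int (tail_sum \<nu> n k)) - int m) div 2)
              (2 * int (n \<nu>))
          * (\<Prod>j=1..\<nu>-1.
              q_binomial (q ^ 3)
                (int i - (\<Sum>k=1..j. int (tail_sum \<nu> n k)) + int (n j)) (int (n j)))
        else 0)"

lemma sum_summand_m:
  assumes n: "n \<in> {1..\<nu>} \<rightarrow>\<^sub>E UNIV"
  shows "(\<Sum>m\<le>3 * n \<nu>. summand \<nu> M i m n)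
    = (q ^ 3) ^ tri (i - 1) * cube.qbin M i * (\<Prod>l=1..\<nu>. (q ^ 3) ^ tri (tail_sum \<nu> n l))
      * (\<Prod>j=1..\<nu>-1. q_binomial (q ^ 3) (int i - (\<Sum>l=1..j. int (tail_sum \<nu> n l)) + int (n j)) (int (n j)))
      * nested 0 (int i - (\<Sum>l=1..\<nu>. int (tail_sum \<nu> n l))) (n \<nu>)"
proof -
  define T where "T = (\<Sum>l=1..\<nu>. tail_sum \<nu> n l)"
  define R where "R = (\<Prod>j=1..\<nu>-1. q_binomial (q ^ 3) (int i - (\<Sum>l=1..j. int (tail_sum \<nu> n l)) + int (n j)) (int (n j)))"
  define U where "U = (\<Sum>l=1..\<nu>. tri (tail_sum \<nu> n l))"
  have iT: "(\<Sum>l=1..\<nu>. int (tail_sum \<nu> n l)) = int T" by (simp add: T_def)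
  have pU: "(\<Prod>l=1..\<nu>. (q ^ 3) ^ tri (tail_sum \<nu> n l)) = (q ^ 3) ^ U"
    by (simp add: U_def power_sum)
  have s: "summand \<nu> M i m n = (if even (i + m + T) then
      q ^ ((m ^ 2 + 3 * (i ^ 2 + (\<Sum>k=1..\<nu>. (tail_sum \<nu> n k) ^ 2))) div 2) * cube.qbin M i * qbin (3 * n \<nu>) m
      * cube.gauss ((int i - int T - int m) div 2) (int (2 * n \<nu>)) * R else 0)" for m
  proof -
    have "[i + m = T] (mod 2) \<longleftrightarrow> even (i + m + T)"
      unfolding cong_def by presburger
    then show ?thesis
      unfolding summand_def iT R_def T_def[symmetric] using n
      by (simp add: cube.q_binomial_eq_gauss q_binomial_eq_gauss cube.qbin_eq_gauss qbin_eq_gauss)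
  qed
  show ?thesis
  proof (cases "T \<le> i")
    case False
    \<comment> \<open>Since \<open>div\<close> rounds down, a negative numerator gives a negative
      first argument.\<close>
    then have c: "cube.gauss ((int i - int T - int m) div 2) (int (2 * n \<nu>)) = 0" for m
      by (intro cube.gauss_neg) simp
    have "nested 0 (int i - int T) (n \<nu>) = 0" using False by simp
    then show ?thesis
      unfolding s iT c by (simp cong: if_cong)
  next
    case True
    then obtain l where i: "i = T + l" by (auto simp: le_iff_add)
    \<comment> \<open>Each tail sum satisfies N^2 = 2 tri(N) - N, and i^2 = 2 tri(i - 1) + i. The
      linear terms combine to i - T = l, giving the 3l/2 that \<open>seed\<close> expects.\<close>
    have e: "(m ^ 2 + 3 * (i ^ 2 + (\<Sum>k=1..\<nu>. (tail_sum \<nu> n k) ^ 2))) div 2 = 3 * (tri (i - 1) + U) + (m ^ 2 + 3 * l) div 2" for m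
    proof -
      have "(\<Sum>k=1..\<nu>. (tail_sum \<nu> n k) ^ 2) + T = 2 * U"
        unfolding T_def U_def sum_distrib_left sum.distrib[symmetric]
        by (rule sum.cong) (simp_all add: two_tri power2_eq_square)
      moreover have "i ^ 2 = 2 * tri (i - 1) + i"
        by (cases i) (simp_all add: two_tri power2_eq_square)
      ultimately have "m ^ 2 + 3 * (i ^ 2 + (\<Sum>k=1..\<nu>. (tail_sum \<nu> n k) ^ 2)) = (m ^ 2 + 3 * l) + 2 * (3 * (tri (i - 1) + U))"
        using i by simp
      then show ?thesis by simp
    qed
    have "(\<Sum>m\<le>3 * n \<nu>. summand \<nu> M i m n) = (q ^ 3) ^ (tri (i - 1) + U) * cube.qbin M i * R * seed l (n \<nu>)"
      unfolding seed_def sum_distrib_left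
    proof (rule sum.cong[OF refl])
      fix m
      have "i + m + T = (l + m) + 2 * T" by (simp add: i)
      then have par: "even (i + m + T) \<longleftrightarrow> even (l + m)" by (simp only: even_add even_mult_iff) simp
      show "summand \<nu> M i m n = (q ^ 3) ^ (tri (i - 1) + U) * cube.qbin M i * R *
        (if even (l + m) \<and> m \<le> l then q ^ ((m ^ 2 + 3 * l) div 2) * qbin (3 * n \<nu>) m * cube.gauss (int ((l - m) div 2)) (int (2 * n \<nu>)) else 0)"
      proof (cases "m \<le> l")
        case False
        then have "cube.gauss ((int i - int T - int m) div 2) (int (2 * n \<nu>)) = 0"
          by (intro cube.gauss_neg) (simp add: i)
        then show ?thesis using False by (simp add: s)
      next
        case True
        then have "(int i - int T - int m) div 2 = int ((l - m) div 2)"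
          by (simp add: i zdiv_int of_nat_diff)
        moreover have "q ^ (3 * (tri (i - 1) + U) + (m ^ 2 + 3 * l) div 2)
          = (q ^ 3) ^ (tri (i - 1) + U) * q ^ ((m ^ 2 + 3 * l) div 2)"
          by (simp only: power_add power_mult)
        ultimately show ?thesis
          unfolding s e par using True by (simp add: mult_ac)
      qed
    qed
    moreover have "nested 0 (int i - int T) (n \<nu>) = seed l (n \<nu>)" by (simp add: i)
    ultimately show ?thesis
      unfolding iT pU R_def[symmetric] by (simp add: power_add mult_ac)
  qed
qed

theorem Sum_any_summand:
  assumes \<nu>: "\<nu> \<ge> 1"
  shows "Sum_any (\<lambda>(i, m, n). summand \<nu> M i m n)
     = Sum_any (\<lambda>j :: int. q powi (3 * int ((\<nu> + 2) choose 2) * j ^ 2 + j)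
         * q_binomial (q ^ 3) (2 * int M) (int M + int (\<nu> + 1) * j))"
proof -
  \<comment> \<open>N records N_1 so that the sum can be arranged by \<open>parts\<close>; h forgets
    it and stays injective because n determines N.\<close>
  define S where "S = (SIGMA i:{..M}. SIGMA N:{..i}. SIGMA n:parts \<nu> 1 N. {..3 * n \<nu>})"
  define h where "h = (\<lambda>(i :: nat, N :: nat, n :: nat \<Rightarrow> nat, m :: nat). (i, m, n))"
  have fin: "finite S"
    unfolding S_def by (intro finite_SigmaI finite_parts finite_atMost)
  have inj: "inj_on h S"
    by (rule inj_onI) (auto simp: S_def h_def parts_def)
  have supp: "{z. (case z of (i, m, n) \<Rightarrow> summand \<nu> M i m n) \<noteq> 0} \<subseteq> h ` S"
  proof
    fix z assume "z \<in> {z. (case z of (i, m, n) \<Rightarrow> summand \<nu> M i m n) \<noteq> 0}"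
    moreover obtain i m n where z: "z = (i, m, n)" by (cases z)
    ultimately have nz: "summand \<nu> M i m n \<noteq> 0" by simp
    define N where "N = sum n {1..\<nu>}"
    from nz have n: "n \<in> {1..\<nu>} \<rightarrow>\<^sub>E UNIV"
      and b: "q_binomial (q ^ 3) (int M) (int i) \<noteq> 0" "q_binomial q (3 * int (n \<nu>)) (int m) \<noteq> 0"
       "q_binomial (q ^ 3) (2 * int (n \<nu>) + (int i - (\<Sum>k=1..\<nu>. int (tail_sum \<nu> n k)) - int m) div 2) (2 * int (n \<nu>)) \<noteq> 0"
      unfolding summand_def by (auto split: if_splits)
    have "i \<le> M" "m \<le> 3 * n \<nu>" using b(1,2) by (auto simp: q_binomial_def split: if_splits)
    \<comment> \<open>The third binomial bounds the sum of all tail sums by i, and N_1 is one of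
      them.\<close>
    moreover have "N \<le> i"
    proof -
      have "(\<Sum>k=1..\<nu>. int (tail_sum \<nu> n k)) \<le> int i"
        using b(3) by (auto simp: q_binomial_def split: if_splits)
      moreover have "int (tail_sum \<nu> n 1) \<le> (\<Sum>k=1..\<nu>. int (tail_sum \<nu> n k))"
        using \<nu> by (intro member_le_sum) auto
      moreover have "tail_sum \<nu> n 1 = N" by (simp add: N_def tail_sum_def)
      ultimately show ?thesis by linarith
    qed
    ultimately have "(i, N, n, m) \<in> S" using n by (simp add: S_def parts_def N_def)
    then show "z \<in> h ` S" by (rule rev_image_eqI) (simp add: h_def z)
  qed
  have "Sum_any (\<lambda>(i, m, n). summand \<nu> M i m n) = (\<Sum>(i, m, n)\<in>h ` S. summand \<nu> M i m n)"
    by (rule Sum_any.expand_superset) (use fin supp in auto)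
  also have "\<dots> = (\<Sum>(i, N, n, m)\<in>S. summand \<nu> M i m n)"
    unfolding sum.reindex[OF inj] by (rule sum.cong) (auto simp: h_def)
  also have "\<dots> = (\<Sum>i\<le>M. \<Sum>N\<le>i. \<Sum>n\<in>parts \<nu> 1 N. \<Sum>m\<le>3 * n \<nu>. summand \<nu> M i m n)"
    unfolding S_def by (simp add: sum.Sigma finite_parts split_def)
  also have "\<dots> = (\<Sum>i\<le>M. (q ^ 3) ^ tri (i - 1) * cube.qbin M i * (\<Sum>N\<le>i. (q ^ 3) ^ tri N * nested (\<nu> - 1) (int i - int N) N))"
    unfolding sum_distrib_left
  proof (intro sum.cong refl)
    fix i N
    let ?T = "\<lambda>n l. int (tail_sum \<nu> n l)"
    have "(\<Sum>m\<le>3 * n \<nu>. summand \<nu> M i m n) = (q ^ 3) ^ tri (i - 1) * cube.qbin M i * (q ^ 3) ^ tri N *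
       ((\<Prod>l=Suc 1..\<nu>. (q ^ 3) ^ tri (tail_sum \<nu> n l))
      * (\<Prod>j=1..<\<nu>. q_binomial (q ^ 3) (int i - int N - (\<Sum>l=Suc 1..j. ?T n l) + int (n j)) (int (n j)))
      * nested 0 (int i - int N - (\<Sum>l=Suc 1..\<nu>. ?T n l)) (n \<nu>))"
      if "n \<in> parts \<nu> 1 N" for n
    proof -
      have n: "n \<in> {1..\<nu>} \<rightarrow>\<^sub>E UNIV" and N: "tail_sum \<nu> n 1 = N"
        using that by (auto simp: parts_def tail_sum_def)
      have ins: "{1..j} = insert 1 {Suc 1..j}" if "1 \<le> j" for j :: nat
        using that by auto
      have S: "(\<Sum>l=1..j. ?T n l) = int N + (\<Sum>l=Suc 1..j. ?T n l)" if "1 \<le> j" for j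
        unfolding ins[OF that] by (simp add: N[simplified])
      have pr: "(\<Prod>l=1..\<nu>. (q ^ 3) ^ tri (tail_sum \<nu> n l)) = (q ^ 3) ^ tri N * (\<Prod>l=Suc 1..\<nu>. (q ^ 3) ^ tri (tail_sum \<nu> n l))"
        unfolding ins[OF \<nu>] by (simp add: N[simplified])
      have ivl: "{1..\<nu> - 1} = {1..<\<nu>}" using \<nu> by auto
      have Q: "(\<Prod>j=1..\<nu>-1. q_binomial (q ^ 3) (int i - (\<Sum>l=1..j. ?T n l) + int (n j)) (int (n j)))
         = (\<Prod>j=1..<\<nu>. q_binomial (q ^ 3) (int i - int N - (\<Sum>l=Suc 1..j. ?T n l) + int (n j)) (int (n j)))"
        unfolding ivl by (rule prod.cong[OF refl]) (simp only: S atLeastLessThan_iff diff_diff_add)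
      show ?thesis
        unfolding sum_summand_m[OF n] pr Q S[OF \<nu>] diff_diff_add[symmetric] by (simp only: mult_ac)
    qed
    then have "(\<Sum>n\<in>parts \<nu> 1 N. \<Sum>m\<le>3 * n \<nu>. summand \<nu> M i m n)
      = (q ^ 3) ^ tri (i - 1) * cube.qbin M i * (q ^ 3) ^ tri N * (\<Sum>n\<in>parts \<nu> 1 N.
       ((\<Prod>l=Suc 1..\<nu>. (q ^ 3) ^ tri (tail_sum \<nu> n l))
      * (\<Prod>j=1..<\<nu>. q_binomial (q ^ 3) (int i - int N - (\<Sum>l=Suc 1..j. ?T n l) + int (n j)) (int (n j)))
      * nested 0 (int i - int N - (\<Sum>l=Suc 1..\<nu>. ?T n l)) (n \<nu>)))"
      by (simp only: sum_distrib_left cong: sum.cong)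
    then show "(\<Sum>n\<in>parts \<nu> 1 N. \<Sum>m\<le>3 * n \<nu>. summand \<nu> M i m n)
      = (q ^ 3) ^ tri (i - 1) * cube.qbin M i * ((q ^ 3) ^ tri N * nested (\<nu> - 1) (int i - int N) N)"
      unfolding sum_parts_nested[OF \<nu>] by (simp only: mult_ac)
  qed
  also have "\<dots> = (\<Sum>j=-int M..int M. q powi (3 * int ((\<nu> + 2) choose 2) * j ^ 2 + j)
         * q_binomial (q ^ 3) (2 * int M) (int M + int (\<nu> + 1) * j))"
  proof -
    have "\<nu> - 1 + 3 = \<nu> + 2" "\<nu> - 1 + 2 = \<nu> + 1" using \<nu> by simp_all
    then show ?thesis unfolding outer_sum by simp
  qed
  also have "\<dots> = Sum_any (\<lambda>j :: int. q powi (3 * int ((\<nu> + 2) choose 2) * j ^ 2 + j)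
         * q_binomial (q ^ 3) (2 * int M) (int M + int (\<nu> + 1) * j))"
  proof (rule Sum_any.expand_superset[symmetric])
    show "{j. q powi (3 * int ((\<nu> + 2) choose 2) * j ^ 2 + j)
         * q_binomial (q ^ 3) (2 * int M) (int M + int (\<nu> + 1) * j) \<noteq> 0} \<subseteq> {-int M..int M}"
    proof
      fix j assume "j \<in> {j. q powi (3 * int ((\<nu> + 2) choose 2) * j ^ 2 + j)
         * q_binomial (q ^ 3) (2 * int M) (int M + int (\<nu> + 1) * j) \<noteq> 0}"
      then have "\<bar>int (\<nu> + 1) * j\<bar> \<le> int M"
        by (auto simp: q_binomial_def split: if_splits)
      moreover have "\<bar>j\<bar> \<le> \<bar>int (\<nu> + 1) * j\<bar>"
        unfolding abs_mult by (rule mult_le_cancel_right1[THEN iffD2]) auto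
      ultimately show "j \<in> {-int M..int M}" by auto
    qed
  qed simp
  finally show ?thesis .
qed

end

lemma qvar_nonzero: "qvar \<noteq> 0"
  by (simp add: qvar_def)

lemma qvar_power_neq_1:
  assumes "k > 0"
  shows "qvar ^ k \<noteq> 1"
proof
  assume "qvar ^ k = 1"
  then have "q_poch (qvar ^ 1) k = 0"
    using assms by (auto simp: q_poch_def intro!: bexI[of _ k])
  with q_poch_qvar_power_nonzero[of 1 k] show False by simp
qed

theorem theorem6p5:
  fixes \<nu> M :: nat
  assumes "\<nu> \<ge> 1"
  shows
    "Sum_any (\<lambda>(i :: nat, m :: nat, n :: nat \<Rightarrow> nat).
        if n \<in> {1..\<nu>} \<rightarrow>\<^sub>E UNIV \<and> [i + m = (\<Sum>k=1..\<nu>. tail_sum \<nu> n k)] (mod 2)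
        then
          qvar ^ ((m ^ 2 + 3 * (i ^ 2 + (\<Sum>k=1..\<nu>. (tail_sum \<nu> n k) ^ 2))) div 2)
          * q_binomial (qvar ^ 3) (int M) (int i)
          * q_binomial qvar (3 * int (n \<nu>)) (int m)
          * q_binomial (qvar ^ 3)
              (2 * int (n \<nu>) + (int i - (\<Sum>k=1..\<nu>. int (tail_sum \<nu> n k)) - int m) div 2)
              (2 * int (n \<nu>))
          * (\<Prod>j=1..\<nu>-1.
              q_binomial (qvar ^ 3)
                (int i - (\<Sum>k=1..j. int (tail_sum \<nu> n k)) + int (n j)) (int (n j)))
        else 0)
     = Sum_any (\<lambda>j :: int.
         qvar powi (3 * int ((\<nu> + 2) choose 2) * j ^ 2 + j)
         * q_binomial (qvar ^ 3) (2 * int M) (int M + int (\<nu> + 1) * j))"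
proof -
  interpret q_cubic qvar
    by unfold_locales (rule qvar_nonzero, erule qvar_power_neq_1)
  show ?thesis
    using Sum_any_summand[OF assms, of M] unfolding summand_def .
qed

end
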